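(* Let $p$ be a prime with $p\equiv 1\pmod 3$ such that $2$ is a cubic residue modulo $p$. Then the number $\mathcal{K}_3(\Gamma(3,p))$ determines the numbers $\mathcal{K}_3(\Gamma(3,p^{\ell}))$ for every $\ell\in\mathbb{N}$, and $$\mathcal{K}_3(\Gamma(3,p^{\ell}))=\frac{p^{\ell}(p^{\ell}-1)(p^{\ell}+c_{\ell}-8)}{162},$$ where $c_{\ell}=-(x_0+3\sqrt{3}\,y_0 i)^{\ell}-(x_0-3\sqrt{3}\,y_0 i)^{\ell}$, with $x_0,y_0\in\mathbb{Z}$ a solution of $p=X^2+27Y^2$ satisfying $(x_0,p)=1$ and $x_0\equiv 1\pmod 3$.
   Context: The generalized Paley graph $\Gamma(k,q)$ is the Cayley graph $\mathrm{Cay}(\mathbb{F}_q,\{x^k: x\in\mathbb{F}_q^*\})$: vertex set $\mathbb{F}_q$, with $v,w$ adjacent iff $w-v$ is a nonzero $k$-th power. For a graph $H$, $\mathcal{K}_{3}(H)$ denotes the number of triangles of $H$. An integer $a$ is a cubic residue modulo $p$ if $a\equiv x^3\pmod p$ for some integer $x$. *)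

theory Defs
  imports
    Complex_Main
    "HOL-Algebra.Coset"
    "HOL-Algebra.Ring"
    "HOL-Number_Theory.Cong"
    "Graph_Theory.Pair_Digraph"
begin

text \<open>
  Finite fields are HOL-Algebra fields. The field with \<open>q\<close> elements is rendered as an arbitrary
  field \<open>R\<close> with \<open>order R = q\<close>, as it is determined by \<open>q\<close> up to isomorphism.

  Graphs are digraphs of \<open>Graph_Theory\<close>; an undirected graph is a symmetric digraph. Cayley graphs
  are formed with respect to the additive group of \<open>R\<close>.
\<close>

definition cayley_graph :: "('a, 'm) ring_scheme \<Rightarrow> 'a set \<Rightarrow> ('a, 'a \<times> 'a) pre_digraph" where
  "cayley_graph R S =
     with_proj \<lparr> pverts = carrier R,
       parcs = {(v, w). v \<in> carrier R \<and> w \<in> carrier R \<and> w \<ominus>\<^bsub>R\<^esub> v \<in> S} \<rparr>"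

definition generalized_paley_graph ::
    "nat \<Rightarrow> ('a, 'm) ring_scheme \<Rightarrow> ('a, 'a \<times> 'a) pre_digraph" where
  "generalized_paley_graph k R =
     cayley_graph R {x [^]\<^bsub>R\<^esub> k | x. x \<in> carrier R - {\<zero>\<^bsub>R\<^esub>}}"

text \<open>
  Triangles are counted as unlabelled vertex sets. Quantifying over ordered pairs of vertices is
  harmless for symmetric digraphs; \<open>generalized_paley_graph 3 R\<close> is symmetric for every field
  \<open>R\<close>, since \<open>-1\<close> is a cube.
\<close>

definition triangles :: "('a, 'b) pre_digraph \<Rightarrow> 'a set set" where
  "triangles H = {T. T \<subseteq> verts H \<and> card T = 3 \<and>
     (\<forall>u\<in>T. \<forall>v\<in>T. u \<noteq> v \<longrightarrow> u \<rightarrow>\<^bsub>H\<^esub> v)}"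

definition num_triangles :: "('a, 'b) pre_digraph \<Rightarrow> nat" where
  "num_triangles H = card (triangles H)"

definition cubic_residue :: "int \<Rightarrow> int \<Rightarrow> bool" where
  "cubic_residue a m \<longleftrightarrow> (\<exists>x::int. [a = x ^ 3] (mod m))"

definition admissible_prime :: "nat \<Rightarrow> bool" where
  "admissible_prime p \<longleftrightarrow> prime p \<and> [p = 1] (mod 3) \<and> cubic_residue 2 (int p)"

definition normalized_solution :: "nat \<Rightarrow> int \<Rightarrow> int \<Rightarrow> bool" where
  "normalized_solution p x y \<longleftrightarrow>
     int p = x ^ 2 + 27 * y ^ 2 \<and> coprime x (int p) \<and> [x = 1] (mod 3)"

definition c_coeff :: "int \<Rightarrow> int \<Rightarrow> nat \<Rightarrow> complex" where
  "c_coeff x y l =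
     - ((of_int x + 3 * of_real (sqrt 3) * of_int y * \<i>) ^ l)
     - (of_int x - 3 * of_real (sqrt 3) * of_int y * \<i>) ^ l"

end

(* An affine map with a cube as its slope moves any edge of a triangle to (0, 1), so 18 times the
   number of triangles over the field with q elements is q (q - 1) A, where A counts the z for which
   both z and 1 - z are nonzero cubes. Let J be the Jacobi sum of a cubic character with itself.
   The symmetries z -> 1 - z and z -> 1/z of the cyclotomic numbers give J = a + b \<omega> with
   3 dividing b and 9 A = c + q - 8, c = 2 a - b congruent to 1 mod 3; the norm equation
   |J|^2 = q then reads c^2 + 27 d^2 = 4 q with d = b / 3.

   Davenport-Hasse is not needed to pass from p to q = p^l: c is determined by the last equation as
   soon as p does not divide c. If p did, it would divide a and b; but the reduction of J at a prime
   above p is the power sum over z of z^(2m) (1 - z)^(2m) with m = (q - 1) / 3, which equals a sign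
   times the central binomial coefficient of 2m, and m + m has no carries in base p.

   For q = p, the involution z -> 1 - z shows that A is odd when 2 is a cube (its only fixed point is
   1/2), so c and d are even and p = x^2 + 27 y^2 is solvable. Finally, the formula with l = 1 is
   injective in p, since for p < p' with equal values p' must divide p - 2 x - 8 < 2 p. *)

theory Submission
  imports Defs "HOL-Number_Theory.Residues"
begin

section \<open>Arithmetic of the norm form\<close>

text \<open>The orbits \<open>{a, f a}\<close> are pairs. The parity of \<open>cyc 0 0\<close> is
  read off from this after its fixed point is removed.\<close>

lemma even_card_involution:
  assumes "finite A" and "\<And>x. x \<in> A \<Longrightarrow> f x \<in> A" and "\<And>x. x \<in> A \<Longrightarrow> f (f x) = x"
    and "\<And>x. x \<in> A \<Longrightarrow> f x \<noteq> x"
  shows "even (card A)"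
  using assms
proof (induction "card A" arbitrary: A rule: less_induct)
  case less
  show ?case
  proof (cases "A = {}")
    case False
    then obtain a where a: "a \<in> A" by blast
    let ?B = "A - {a, f a}"
    have fa: "f a \<in> A" "f a \<noteq> a" using less.prems a by auto
    have cA: "card A = Suc (Suc (card ?B))"
      using card_Suc_Diff1[of A a] card_Suc_Diff1[of "A - {a}" "f a"] less.prems(1) a fa
      by (simp add: insert_commute Diff_insert2[symmetric] Diff_insert[symmetric])
    have "even (card ?B)"
    proof (rule less.hyps)
      show "card ?B < card A" using cA by simp
      fix x assume x: "x \<in> ?B"
      show "f x \<in> ?B" using x less.prems(2,3) a by (metis Diff_iff insert_iff empty_iff)
      show "f (f x) = x" "f x \<noteq> x" using x less.prems by auto
    qed (use less.prems(1) in simp)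
    then show ?thesis using cA by simp
  qed simp
qed

text \<open>One step of Legendre's formula: the multiples of \<open>p\<close> among the factors
  contribute \<open>p ^ n * fact n\<close>, and all other factors are prime to
  \<open>p\<close>.\<close>

lemma fact_mult_add_not_dvd:
  fixes p :: nat
  assumes "prime p" "r < p"
  obtains u where "fact (p * n + r) = p ^ n * fact n * u" "\<not> p dvd u"
  using assms(2)
proof (induction n arbitrary: r thesis)
  case 0
  show ?case by (rule 0(1)[of "fact r"]) (use 0(2) assms(1) in \<open>auto simp: prime_dvd_fact_iff\<close>)
next
  case (Suc n)
  have p: "p > 0" "Suc (p - 1) = p" using assms(1) prime_gt_0_nat by auto
  obtain u where u: "fact (p * n + (p - 1)) = p ^ n * fact n * u" "\<not> p dvd u"
    using Suc.IH[of "p - 1"] p by (metis diff_less zero_less_one)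
  have "\<exists>v. fact (p * Suc n + r) = p ^ Suc n * fact (Suc n) * v \<and> \<not> p dvd v"
    using Suc.prems(2)
  proof (induction r)
    case 0
    have "p * Suc n + 0 = Suc (p * n + (p - 1))" using p by simp
    then have "fact (p * Suc n + 0) = (p * Suc n) * fact (p * n + (p - 1))"
      by (metis fact_Suc add.right_neutral of_nat_id)
    also have "\<dots> = p ^ Suc n * fact (Suc n) * u" using u by (simp add: algebra_simps)
    finally show ?case using u(2) by blast
  next
    case (Suc r)
    then obtain v where v: "fact (p * Suc n + r) = p ^ Suc n * fact (Suc n) * v" "\<not> p dvd v"
      by auto
    have "\<not> p dvd Suc r" using Suc.prems by (meson nat_dvd_not_less zero_less_Suc)
    then have "\<not> p dvd (p * Suc n + Suc r)" by (metis dvd_add_right_iff dvd_triv_left)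
    then have "\<not> p dvd (p * Suc n + Suc r) * v" using v(2) assms(1) prime_dvd_mult_iff by blast
    moreover have "fact (p * Suc n + Suc r) = p ^ Suc n * fact (Suc n) * ((p * Suc n + Suc r) * v)"
      using v(1) by (simp add: algebra_simps)
    ultimately show ?case by blast
  qed
  then show ?case using Suc.prems(1) by blast
qed

text \<open>The base-\<open>p\<close> digits of \<open>m = (p ^ l - 1) / 3\<close> all equal \<open>(p - 1) / 3\<close>, so that \<open>m + m\<close> is
  computed without carries.\<close>

lemma not_dvd_central_binomial:
  fixes p :: nat
  assumes "prime p" "3 * m + 1 = p ^ l" "[p = 1] (mod 3)"
  shows "\<not> p dvd (2 * m choose m)"
  using assms(2)
proof (induction l arbitrary: m)
  case 0
  then show ?case using assms(1) by auto
next
  case (Suc l)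
  have p1: "p > 1" using assms(1) prime_gt_1_nat by blast
  have "p mod 3 = 1" using assms(3) by (simp add: cong_def)
  then obtain s where s: "p = 3 * s + 1" by (metis mod_div_decomp mult.commute)
  have "p ^ l mod 3 = 1"
    using power_mod[of p 3 l] \<open>p mod 3 = 1\<close> by simp
  then obtain n where n: "3 * n + 1 = p ^ l" by (metis mod_div_decomp mult.commute)
  have m: "m = p * n + s" 
  proof -
    have "3 * m + 1 = (3 * n + 1) * p" using Suc.prems n by simp
    then show ?thesis using s by (simp add: algebra_simps)
  qed
  \<comment> \<open>As \<open>2 * s < p\<close>, this is division with remainder: doubling acts on
    the quotient and on the last digit separately.\<close>
  have m2: "2 * m = p * (2 * n) + 2 * s" using m by simp
  obtain u where u: "fact (2 * m) = p ^ (2 * n) * fact (2 * n) * u" "\<not> p dvd u"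
    using fact_mult_add_not_dvd[OF assms(1), of "2 * s" "2 * n"] s p1 m2 by auto
  obtain v where v: "fact m = p ^ n * fact n * v" "\<not> p dvd v"
    using fact_mult_add_not_dvd[OF assms(1), of s n] s m by auto
  have "fact m * fact m * (2 * m choose m) = fact (2 * m)"
    using binomial_fact_lemma[of m "2 * m"] by (simp add: mult_2)
  moreover have "fact n * fact n * (2 * n choose n) = fact (2 * n)"
    using binomial_fact_lemma[of n "2 * n"] by (simp add: mult_2)
  ultimately have "(p ^ n * fact n * v) * (p ^ n * fact n * v) * (2 * m choose m)
      = p ^ (2 * n) * (fact n * fact n * (2 * n choose n)) * u"
    using u v by simp
  \<comment> \<open>All powers of \<open>p\<close> cancel, so the central binomial coefficients of
    \<open>m\<close> and \<open>n\<close> agree up to factors prime to \<open>p\<close>, as in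
    Lucas' theorem.\<close>
  then have "(p ^ n * fact n) ^ 2 * (v * v * (2 * m choose m)) = (p ^ n * fact n) ^ 2 * ((2 * n choose n) * u)"
    by (simp add: power2_eq_square algebra_simps power_mult power_add mult_2)
  then have "v * v * (2 * m choose m) = (2 * n choose n) * u"
    using p1 by simp
  moreover have "\<not> p dvd (2 * n choose n) * u"
    using Suc.IH[OF n] u(2) assms(1) by (simp add: prime_dvd_mult_iff)
  ultimately show ?case by (metis dvd_mult)
qed


text \<open>Up to the sign of \<open>d\<close>, \<open>p ^ l\<close> divides \<open>c * Y - d * X\<close>, and the product formula for the two norm
  forms makes this number too small to be nonzero.\<close>

lemma norm_form_unique:
  fixes p c d X Y :: int
  assumes "prime p" "p \<noteq> 2" "l \<ge> 1"
    and cd: "c ^ 2 + 27 * d ^ 2 = 4 * p ^ l" and XY: "X ^ 2 + 27 * Y ^ 2 = p ^ l"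
    and "\<not> p dvd c" "\<not> p dvd X"
  shows "c = 2 * X \<or> c = - 2 * X"
proof -
  \<comment> \<open>Here \<open>d\<close> is a fresh variable, so that the fact serves both for the
    given \<open>d\<close> and for its negative.\<close>
  have key: "c = 2 * X \<or> c = - 2 * X"
    if cd: "c ^ 2 + 27 * d ^ 2 = 4 * p ^ l" and dvd: "p ^ l dvd c * Y - d * X" for d
  proof -
    obtain k where k: "c * Y - d * X = p ^ l * k" using dvd by blast
    have p0: "p > 0" using assms(1) prime_gt_0_int by simp
    then have q: "p ^ l > 0" by simp
    \<comment> \<open>Brahmagupta's identity. As the second square is a multiple of
      \<open>(p ^ l) ^ 2\<close>, it leaves \<open>27 * k ^ 2 \<le> 4\<close>, hence
      \<open>k = 0\<close>.\<close>
    have "(c * X + 27 * d * Y) ^ 2 + 27 * (c * Y - d * X) ^ 2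
        = (c ^ 2 + 27 * d ^ 2) * (X ^ 2 + 27 * Y ^ 2)"
      by (simp add: power2_eq_square algebra_simps)
    also have "\<dots> = 4 * (p ^ l) ^ 2" using cd XY by (simp add: power2_eq_square)
    finally have "(c * X + 27 * d * Y) ^ 2 + (p ^ l) ^ 2 * (27 * k ^ 2) = (p ^ l) ^ 2 * 4"
      unfolding k by (simp add: power_mult_distrib mult_ac)
    then have "(p ^ l) ^ 2 * (27 * k ^ 2) \<le> (p ^ l) ^ 2 * 4"
      using zero_le_power2[of "c * X + 27 * d * Y"] by linarith
    then have "27 * k ^ 2 \<le> 4" by (rule mult_left_le_imp_le) (rule zero_less_power[OF q])
    then have "\<not> k ^ 2 > 0" by linarith
    then have "k = 0" by simp
    then have "c * Y = d * X" using k by simp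
    then have "c ^ 2 * Y ^ 2 = d ^ 2 * X ^ 2" by (metis power_mult_distrib)
    then have "c ^ 2 * (X ^ 2 + 27 * Y ^ 2) = X ^ 2 * (c ^ 2 + 27 * d ^ 2)"
      by (simp add: algebra_simps)
    then have "c ^ 2 * p ^ l = (4 * X ^ 2) * p ^ l" unfolding XY cd by (simp only: mult_ac)
    then have "c ^ 2 = (2 * X) ^ 2" using p0 by (simp add: power_mult_distrib)
    then show ?thesis using power2_eq_iff by fastforce
  qed
  have "(c * Y - d * X) * (c * Y + d * X) = Y ^ 2 * (c ^ 2 + 27 * d ^ 2) - d ^ 2 * (X ^ 2 + 27 * Y ^ 2)"
    by (simp add: power2_eq_square algebra_simps)
  also have "\<dots> = p ^ l * (4 * Y ^ 2 - d ^ 2)" using cd XY by (simp add: algebra_simps)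
  finally have dvd: "p ^ l dvd (c * Y - d * X) * (c * Y + d * X)" by simp
  have "\<not> p dvd Y"
  proof
    assume "p dvd Y"
    then have "p dvd X ^ 2 + 27 * Y ^ 2 - 27 * Y ^ 2"
      using XY assms(3) by (intro dvd_diff) (simp_all add: power2_eq_square)
    then show False using assms(1,7) prime_dvd_power by (metis add_diff_cancel_right')
  qed
  moreover have "\<not> p dvd 2" using assms(1,2) by (metis primes_dvd_imp_eq two_is_prime)
  \<comment> \<open>The sum of the two factors is \<open>2 * c * Y\<close>, which is prime to
    \<open>p\<close>; so one factor is prime to \<open>p\<close> and the other absorbs all of
    \<open>p ^ l\<close>.\<close>
  ultimately have "\<not> p dvd (c * Y - d * X) + (c * Y + d * X)"
    using assms(1,6) by (auto simp: prime_dvd_mult_iff algebra_simps)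
  then have "\<not> p dvd c * Y - d * X \<or> \<not> p dvd c * Y + d * X" using dvd_add by blast
  then show ?thesis
  proof
    assume "\<not> p dvd c * Y - d * X"
    then have "coprime (p ^ l) (c * Y - d * X)"
      using assms(1) prime_imp_coprime coprime_power_left_iff by blast
    then have "p ^ l dvd c * Y + d * X" using dvd coprime_dvd_mult_right_iff by blast
    then have "p ^ l dvd c * Y - (- d) * X" by simp
    then show ?thesis using key[of "- d"] cd by simp
  next
    assume "\<not> p dvd c * Y + d * X"
    then have "coprime (p ^ l) (c * Y + d * X)"
      using assms(1) prime_imp_coprime coprime_power_left_iff by blast
    then have "p ^ l dvd c * Y - d * X" using dvd coprime_dvd_mult_left_iff by blast
    then show ?thesis using key[of d] cd by simp
  qed
qed

lemma admissible_primeD: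
  assumes "admissible_prime p"
  shows "prime p" "[p = 1] (mod 3)" "p \<ge> 7" "odd p"
proof -
  show p: "prime p" "[p = 1] (mod 3)" using assms by (simp_all add: admissible_prime_def)
  then have "p > 1" "p mod 3 = 1" using prime_gt_1_nat by (auto simp: cong_def)
  moreover from this have "p \<noteq> 2" "p \<noteq> 3" "p \<noteq> 5" "p \<noteq> 6" by auto
  moreover have "\<not> prime (2 * 2 :: nat)" using prime_product[of 2 2] by force
  ultimately show "p \<ge> 7" using p by (cases "p = 4") auto
  then show "odd p" using p(1) prime_odd_nat by simp
qed

text \<open>Powers of \<open>x + 3 sqrt(-3) y\<close> keep the shape
  \<open>X + 3 sqrt(-3) Y\<close>, and the conjugate power differs only in the sign of
  \<open>Y\<close>. The norm is multiplicative, and the residue of \<open>X\<close> modulo 3 later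
  settles a sign.\<close>

lemma c_coeff_norm_form:
  assumes "normalized_solution p x y" "prime p" "odd p" "l \<ge> 1"
  obtains X Y :: int where "c_coeff x y l = of_int (- 2 * X)" "X ^ 2 + 27 * Y ^ 2 = int p ^ l"
    "[X = 1] (mod 3)" "\<not> int p dvd X"
proof -
  have p: "int p = x ^ 2 + 27 * y ^ 2" and cop: "coprime x (int p)" and x3: "[x = 1] (mod 3)"
    using assms(1) by (auto simp: normalized_solution_def)
  have pp: "prime (int p)" using assms(2) by simp
  have ndx: "\<not> int p dvd x"
    using cop pp by (metis coprime_absorb_right not_prime_unit)
  have "\<not> int p dvd 2" using assms(2,3) pp by (metis primes_dvd_imp_eq two_is_prime even_of_nat dvd_refl)
  then have nd2: "\<not> int p dvd 2 * x" using ndx pp prime_dvd_mult_iff by blast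
  define z where "z = (of_int x + 3 * of_real (sqrt 3) * of_int y * \<i> :: complex)"
  define w where "w = (of_int x - 3 * of_real (sqrt 3) * of_int y * \<i> :: complex)"
  have s3: "(of_real (sqrt 3) :: complex) * of_real (sqrt 3) = 3"
    by (simp flip: of_real_mult)
  \<comment> \<open>The last conjunct strengthens the induction. It concerns the real part of
    \<open>w * z ^ l\<close>, which is \<open>p\<close> times that of \<open>z ^ (l - 1)\<close>;
    added to the new \<open>X\<close> it gives \<open>2 * x * X\<close>, which keeps the new
    \<open>X\<close> prime to \<open>p\<close>.\<close>
  have "\<exists>X Y :: int. z ^ l = of_int X + 3 * of_real (sqrt 3) * of_int Y * \<i> \<and>
      w ^ l = of_int X - 3 * of_real (sqrt 3) * of_int Y * \<i> \<and>
      X ^ 2 + 27 * Y ^ 2 = int p ^ l \<and> [X = 1] (mod 3) \<and> \<not> int p dvd X \<and>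
      int p dvd x * X + 27 * y * Y"
    using assms(4)
  proof (induction l rule: nat_induct_at_least)
    case base
    show ?case
      by (rule exI[of _ x], rule exI[of _ y])
        (use p x3 ndx in \<open>simp add: z_def w_def power2_eq_square algebra_simps\<close>)
  next
    case (Suc n)
    then obtain X Y where IH: "z ^ n = of_int X + 3 * of_real (sqrt 3) * of_int Y * \<i>"
      "w ^ n = of_int X - 3 * of_real (sqrt 3) * of_int Y * \<i>"
      "X ^ 2 + 27 * Y ^ 2 = int p ^ n" "[X = 1] (mod 3)" "\<not> int p dvd X"
      "int p dvd x * X + 27 * y * Y" by blast
    define X' Y' where X': "X' = x * X - 27 * y * Y" and Y': "Y' = x * Y + y * X"
    have "z ^ Suc n = of_int X' + 3 * of_real (sqrt 3) * of_int Y' * \<i>"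
      "w ^ Suc n = of_int X' - 3 * of_real (sqrt 3) * of_int Y' * \<i>"
      unfolding power_Suc IH unfolding X' Y' z_def w_def using s3 by (simp_all add: algebra_simps)
    moreover have "X' ^ 2 + 27 * Y' ^ 2 = (x ^ 2 + 27 * y ^ 2) * (X ^ 2 + 27 * Y ^ 2)"
      by (simp add: X' Y' power2_eq_square algebra_simps)
    then have "X' ^ 2 + 27 * Y' ^ 2 = int p ^ Suc n" using p IH(3) by simp
    moreover have "[X' = 1] (mod 3)"
    proof -
      have "[X' = 1 * 1 - 0 * y * Y] (mod 3)"
        unfolding X' by (intro cong_diff cong_mult x3 IH(4) cong_refl) (simp add: cong_def)
      then show ?thesis by simp
    qed
    moreover have "\<not> int p dvd X'"
    proof
      assume "int p dvd X'"
      then have "int p dvd X' + (x * X + 27 * y * Y)" using IH(6) dvd_add by blast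
      then have "int p dvd (2 * x) * X" by (simp add: X' algebra_simps)
      then show False using nd2 IH(5) pp prime_dvd_mult_iff by blast
    qed
    moreover have "x * X' + 27 * y * Y' = (x ^ 2 + 27 * y ^ 2) * X"
      by (simp add: X' Y' power2_eq_square algebra_simps)
    then have "int p dvd x * X' + 27 * y * Y'" using p by simp
    ultimately show ?case by blast
  qed
  then obtain X Y :: int where XY: "z ^ l = of_int X + 3 * of_real (sqrt 3) * of_int Y * \<i>"
      "w ^ l = of_int X - 3 * of_real (sqrt 3) * of_int Y * \<i>"
      "X ^ 2 + 27 * Y ^ 2 = int p ^ l" "[X = 1] (mod 3)" "\<not> int p dvd X"
    by blast
  have "c_coeff x y l = - (z ^ l) - w ^ l" by (simp add: c_coeff_def z_def w_def)
  also have "\<dots> = of_int (- 2 * X)" by (simp add: XY)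
  finally show ?thesis using that XY by blast
qed

text \<open>For \<open>p < p'\<close> the prime \<open>p'\<close> divides
  \<open>u = p - 2 x - 8\<close>, which lies strictly between 0 and \<open>2 p\<close>, so
  \<open>u = p'\<close>. What remains is \<open>p (p - 1) = (p' - 1) u'\<close>. If \<open>p\<close>
  divides \<open>p' - 1\<close>, then \<open>p' = p + 1\<close>, against parity; if \<open>p\<close>
  divides \<open>u'\<close>, the right side is too large.\<close>

lemma normalized_triangle_formula_inj:
  fixes p p' :: nat
  assumes adm: "prime p" "odd p" "prime p'" "odd p'"
    and norm: "normalized_solution p x y" "normalized_solution p' x' y'"
    and eq: "int p * (int p - 1) * (int p - 2 * x - 8) = int p' * (int p' - 1) * (int p' - 2 * x' - 8)"
  shows "p = p' \<and> x = x'"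
proof -
  have bounds: "0 < int p - 2 * x - 8 \<and> int p - 2 * x - 8 < 2 * int p"
    if "prime p" "normalized_solution p x y" for p x y
  proof -
    have p: "int p = x ^ 2 + 27 * y ^ 2" using that by (simp add: normalized_solution_def)
    have "y \<noteq> 0"
    proof
      assume "y = 0"
      then have "prime (x ^ 2)" using p that(1) by (metis prime_nat_int_transfer add.right_neutral mult_zero_right zero_power2)
      then show False by (simp add: prime_power_iff)
    qed
    then have "y ^ 2 \<ge> 1" using zero_less_power2[of y] by linarith
    \<comment> \<open>The two bounds are \<open>p - 2 x - 8 = (x - 1)^2 + 27 y^2 - 9\<close> and
      \<open>p + 2 x + 8 = (x + 1)^2 + 27 y^2 + 7\<close>, both positive once \<open>y\<close> is
      nonzero.\<close>
    moreover have "(x - 1) ^ 2 \<ge> 0" "(x + 1) ^ 2 \<ge> 0" by simp_all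
    ultimately show ?thesis using p by (simp add: power2_eq_square algebra_simps)
  qed
  have aux: False
    if "p < p'" "prime p" "odd p" "prime p'" "odd p'"
      "normalized_solution p x y" "normalized_solution p' x' y'"
      and eq: "int p * (int p - 1) * (int p - 2 * x - 8) = int p' * (int p' - 1) * (int p' - 2 * x' - 8)"
    for p p' :: nat and x x' y y'
  proof -
    define u u' where u: "u = int p - 2 * x - 8" and u': "u' = int p' - 2 * x' - 8"
    have b: "0 < u" "u < 2 * int p" "0 < u'"
      using bounds that(2,4,6,7) by (auto simp: u u')
    have pp: "prime (int p)" "prime (int p')" using that by auto
    have p1: "int p > 1" using pp prime_gt_1_int by blast
    have "int p' dvd int p * (int p - 1) * u" using eq unfolding u by simp
    moreover have "\<not> int p' dvd int p" "\<not> int p' dvd int p - 1"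
      using that(1) p1 zdvd_not_zless[of "int p"  "int p'"] zdvd_not_zless[of "int p - 1"  "int p'"] by auto
    ultimately have "int p' dvd u" using pp prime_dvd_mult_iff by blast
    then obtain k where k: "u = int p' * k" by blast
    have "k > 0" using k b(1) p1 that(1) by (simp add: zero_less_mult_iff)
    moreover have "k < 2"
    proof (rule ccontr)
      assume "\<not> k < 2"
      then have "int p' * 2 \<le> int p' * k" by (intro mult_left_mono) auto
      then show False using k b(2) that(1) by linarith
    qed
    ultimately have u_eq: "u = int p'" using k by (simp add: order_antisym)
    have "int p' * (int p * (int p - 1)) = int p' * ((int p' - 1) * u')"
      using eq unfolding u[symmetric] u'[symmetric] u_eq by (simp add: algebra_simps)
    then have eq2: "int p * (int p - 1) = (int p' - 1) * u'" using p1 that(1) by simp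
    then have "int p dvd (int p' - 1) * u'" by (metis dvd_triv_left)
    then consider "int p dvd int p' - 1" | "int p dvd u'" using pp prime_dvd_mult_iff by blast
    then show False
    proof cases
      case 1
      then obtain j where j: "int p' - 1 = int p * j" by blast
      have "j > 0" using j p1 that(1) zero_less_mult_pos[of "int p" j] by linarith
      moreover have "j < 2"
      proof (rule ccontr)
        assume "\<not> j < 2"
        then have "int p * 2 \<le> int p * j" by (intro mult_left_mono) auto
        then show False using j b(2) u_eq by linarith
      qed
      ultimately have "int p' - 1 = int p" using j by (simp add: order_antisym)
      then have "p' = Suc p" by linarith
      then show False using that by simp
    next
      case 2
      then obtain j where j: "u' = int p * j" by blast
      have "j > 0" using j b(3) p1 by (simp add: zero_less_mult_iff)
      have "int p * (int p - 1) = int p * ((int p' - 1) * j)" using eq2 j by (simp add: algebra_simps)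
      then have "int p - 1 = (int p' - 1) * j" using p1 by simp
      moreover have "(int p' - 1) * 1 \<le> (int p' - 1) * j"
        using \<open>j > 0\<close> p1 that(1) by (intro mult_left_mono) auto
      ultimately show False using that(1) by simp
    qed
  qed
  have "p = p'"
    using aux[OF _ adm norm eq] aux[OF _ adm(3,4,1,2) norm(2,1) eq[symmetric]] by (meson linorder_neqE_nat)
  moreover have "int p * (int p - 1) \<noteq> 0" using adm(1) prime_gt_1_nat[of p] by simp
  ultimately show ?thesis using eq by simp
qed

section \<open>Jacobi sums and cyclotomic numbers of order three\<close>

definition \<omega> :: complex where
  "\<omega> = Complex (- 1 / 2) (sqrt 3 / 2)"

lemma \<omega>_square: "\<omega> ^ 2 = cnj \<omega>"
  by (simp add: \<omega>_def complex_eq_iff power2_eq_square)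

lemma \<omega>_cube: "\<omega> ^ 3 = 1"
proof -
  have "\<omega> ^ 3 = \<omega> ^ 2 * \<omega>" by (simp add: power3_eq_cube power2_eq_square)
  also have "\<dots> = 1" unfolding \<omega>_square by (simp add: \<omega>_def complex_eq_iff)
  finally show ?thesis .
qed

lemma \<omega>_sum: "1 + \<omega> + \<omega> ^ 2 = 0"
  unfolding \<omega>_square by (simp add: \<omega>_def complex_eq_iff)

lemma \<omega>_power_mod: "\<omega> ^ (n mod 3) = \<omega> ^ n"
proof -
  have "\<omega> ^ n = \<omega> ^ (3 * (n div 3) + n mod 3)" by simp
  also have "\<dots> = \<omega> ^ (n mod 3)" unfolding power_add power_mult by (simp add: \<omega>_cube)
  finally show ?thesis by simp
qed

lemma cnj_\<omega>_power: "cnj (\<omega> ^ n) = \<omega> ^ (2 * n)"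
  by (simp add: power_mult \<omega>_square)

lemma norm_\<omega>_combination:
  fixes a b :: int
  shows "(of_int a + of_int b * \<omega>) * cnj (of_int a + of_int b * \<omega>) = of_int (a ^ 2 - a * b + b ^ 2)"
  by (simp add: \<omega>_def complex_eq_iff power2_eq_square algebra_simps)

text \<open>A finite field with a chosen primitive root \<open>g\<close>. The number
  \<open>m = (q - 1) / 3\<close> counts the nonzero cubes, and \<open>g [^] m\<close> is a primitive
  cube root of unity in the field.\<close>

locale cubic_field = field R for R (structure) +
  fixes g :: 'a and m :: nat
  assumes finite_carrier [simp]: "finite (carrier R)"
    and order_eq: "order R = 3 * m + 1"
    and g_carrier [simp]: "g \<in> carrier R" and g_nonzero [simp]: "g \<noteq> \<zero>"
    and g_generates: "carrier R - {\<zero>} = {g [^] k | k :: nat. True}"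
begin

lemma card_carrier: "card (carrier R) = 3 * m + 1"
  using order_eq by (simp add: order_def)

lemma m_pos: "m > 0"
proof (rule ccontr)
  assume "\<not> m > 0"
  then have "card (carrier R) = 1" using card_carrier by simp
  moreover have "card {\<zero>, \<one>} \<le> card (carrier R)" by (intro card_mono) auto
  ultimately show False by simp
qed

lemma pow_nonzero [simp]: "x \<in> carrier R \<Longrightarrow> x \<noteq> \<zero> \<Longrightarrow> x [^] (k :: nat) \<noteq> \<zero>"
  by (induction k) (auto simp: integral_iff)

text \<open>The powers of \<open>g\<close> exhaust the multiplicative group, so the order of
  \<open>g\<close> is exactly \<open>3 * m\<close>.\<close>

lemma g_pow_eq_iff: "g [^] i = g [^] j \<longleftrightarrow> i mod (3 * m) = j mod (3 * m)" for i j :: nat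
proof -
  interpret M: group "mult_of R" by (rule field_mult_group)
  have g: "g \<in> carrier (mult_of R)" by simp
  have fin: "finite (carrier (mult_of R))" by simp
  have "order (mult_of R) = 3 * m" using order_mult_of order_eq by simp
  moreover have "M.ord g = order (mult_of R)"
  proof -
    have "carrier (mult_of R) = {g [^]\<^bsub>mult_of R\<^esub> x | x :: nat. x \<in> UNIV}"
      using g_generates by (simp add: nat_pow_mult_of)
    also have "\<dots> = (\<lambda>x. g [^]\<^bsub>mult_of R\<^esub> x) ` {0..M.ord g - 1}"
      using M.ord_elems[OF fin g] by (auto simp: image_def)
    finally have "order (mult_of R) \<le> M.ord g"
      unfolding order_def using card_image_le[of "{0..M.ord g - 1}" "\<lambda>x. g [^]\<^bsub>mult_of R\<^esub> x"]
        M.ord_ge_1[OF fin g] by simp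
    then show ?thesis using M.ord_le_group_order[OF fin g] by (simp add: order_antisym)
  qed
  ultimately have ord: "M.ord g = 3 * m" by simp
  have key: "g [^] i = g [^] j \<longleftrightarrow> i mod (3 * m) = j mod (3 * m)" if "i \<le> j" for i j :: nat
  proof -
    have "g [^] i = g [^] j \<longleftrightarrow> g [^] (j - i) = \<one>"
    proof -
      have "g [^] j = g [^] (j - i) \<otimes> g [^] i" using that by (simp add: nat_pow_mult)
      then show ?thesis using m_rcancel[of "g [^] i" "g [^] (j - i)" \<one>] by auto
    qed
    also have "\<dots> \<longleftrightarrow> 3 * m dvd j - i" using M.pow_eq_id[OF g] ord by (simp add: nat_pow_mult_of)
    also have "\<dots> \<longleftrightarrow> j mod (3 * m) = i mod (3 * m)" using that by (simp add: mod_eq_dvd_iff_nat)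
    finally show ?thesis by auto
  qed
  show ?thesis using key[of i j] key[of j i] by (cases "i \<le> j") auto
qed

text \<open>The discrete logarithm modulo 3; its value at zero is arbitrary.\<close>

definition \<kappa> :: "'a \<Rightarrow> nat" where
  "\<kappa> z = (SOME k. g [^] k = z) mod 3"

text \<open>The choice of exponent does no harm: exponents are determined modulo
  \<open>3 * m\<close>, hence modulo 3.\<close>

lemma \<kappa>_pow: "\<kappa> (g [^] k) = k mod 3"
proof -
  let ?j = "SOME j :: nat. g [^] j = g [^] k"
  have "g [^] ?j = g [^] k" by (rule someI[of "\<lambda>j. g [^] j = g [^] k" k]) simp
  then have "?j mod (3 * m) = k mod (3 * m)" using g_pow_eq_iff by blast
  then have "?j mod (3 * m) mod 3 = k mod (3 * m) mod 3" by simp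
  then show ?thesis unfolding \<kappa>_def by (simp add: mod_mod_cancel)
qed

lemma nonzero_pow:
  assumes "z \<in> carrier R" "z \<noteq> \<zero>"
  obtains k where "k < 3 * m" "z = g [^] k"
proof -
  obtain k :: nat where "z = g [^] k" using g_generates assms by blast
  then have "z = g [^] (k mod (3 * m))" using g_pow_eq_iff by simp
  then show ?thesis using that[of "k mod (3 * m)"] m_pos by simp
qed

lemma \<kappa>_less: "\<kappa> z < 3"
  by (simp add: \<kappa>_def)

lemma \<kappa>_values: "\<kappa> z = 0 \<or> \<kappa> z = 1 \<or> \<kappa> z = 2"
  using \<kappa>_less[of z] by linarith

lemma \<kappa>_mult:
  assumes "x \<in> carrier R" "x \<noteq> \<zero>" "y \<in> carrier R" "y \<noteq> \<zero>"
  shows "\<kappa> (x \<otimes> y) = (\<kappa> x + \<kappa> y) mod 3"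
proof -
  obtain i j :: nat where "x = g [^] i" "y = g [^] j" by (meson assms nonzero_pow)
  then show ?thesis by (simp add: nat_pow_mult \<kappa>_pow mod_add_eq)
qed

lemma \<kappa>_one [simp]: "\<kappa> \<one> = 0"
  using \<kappa>_pow[of 0] by simp

text \<open>The square of \<open>\<ominus> \<one>\<close> is \<open>\<one>\<close>, and 2 is
  invertible modulo 3.\<close>

lemma \<kappa>_minus_one: "\<kappa> (\<ominus> \<one>) = 0"
proof -
  have "(\<kappa> (\<ominus> \<one>) + \<kappa> (\<ominus> \<one>)) mod 3 = 0"
    using \<kappa>_mult[of "\<ominus> \<one>" "\<ominus> \<one>"] by (simp add: l_minus r_minus add.inv_eq_1_iff)
  then show ?thesis using \<kappa>_values[of "\<ominus> \<one>"] by (auto dest: dvd_imp_le)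
qed

lemma \<kappa>_minus:
  assumes "x \<in> carrier R" "x \<noteq> \<zero>"
  shows "\<kappa> (\<ominus> x) = \<kappa> x"
  using \<kappa>_mult[of "\<ominus> \<one>" x] assms \<kappa>_minus_one \<kappa>_less[of x]
  by (simp add: l_minus add.inv_eq_1_iff)

lemma \<kappa>_inv:
  assumes "x \<in> carrier R" "x \<noteq> \<zero>"
  shows "\<kappa> (inv x) = (2 * \<kappa> x) mod 3"
proof -
  have "inv x \<in> carrier R" "inv x \<noteq> \<zero>" "x \<otimes> inv x = \<one>" using assms field_Units by auto
  then have "(\<kappa> x + \<kappa> (inv x)) mod 3 = 0" using \<kappa>_mult[of x "inv x"] assms by simp
  then show ?thesis
    using \<kappa>_values[of x] \<kappa>_values[of "inv x"] by (auto dest: dvd_imp_le)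
qed

text \<open>Raising to the power \<open>m\<close> is the cubic character with values in the field
  itself; \<open>g [^] m\<close> takes the place of a complex cube root of unity.\<close>

lemma pow_m:
  assumes "x \<in> carrier R" "x \<noteq> \<zero>"
  shows "x [^] m = (g [^] m) [^] \<kappa> x"
proof -
  obtain k :: nat where k: "x = g [^] k" using assms nonzero_pow by blast
  have "k * m = (k div 3) * (3 * m) + m * (k mod 3)"
    by (metis add_mult_distrib div_mult_mod_eq mult.assoc mult.commute)
  then have "(k * m) mod (3 * m) = (m * (k mod 3)) mod (3 * m)" by simp
  then show ?thesis using k by (simp add: nat_pow_pow \<kappa>_pow g_pow_eq_iff)
qed

lemma cubes_eq: "{x [^] (3 :: nat) | x. x \<in> carrier R - {\<zero>}} = {z \<in> carrier R - {\<zero>}. \<kappa> z = 0}"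
proof (intro equalityI subsetI)
  fix z assume "z \<in> {x [^] (3 :: nat) | x. x \<in> carrier R - {\<zero>}}"
  then obtain x where x: "x \<in> carrier R" "x \<noteq> \<zero>" "z = x [^] (3 :: nat)" by auto
  obtain k :: nat where "x = g [^] k" using x nonzero_pow by blast
  then have "z = g [^] (k * 3)" using x by (simp add: nat_pow_pow)
  then show "z \<in> {z \<in> carrier R - {\<zero>}. \<kappa> z = 0}" by (simp add: \<kappa>_pow)
next
  fix z assume z: "z \<in> {z \<in> carrier R - {\<zero>}. \<kappa> z = 0}"
  then obtain k :: nat where k: "z = g [^] k" by (auto elim: nonzero_pow)
  then have "k mod 3 = 0" using z by (simp add: \<kappa>_pow)
  then have "k div 3 * 3 = k" by presburger
  then have "z = (g [^] (k div 3)) [^] (3 :: nat)" using k by (simp add: nat_pow_pow)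
  moreover have "g [^] (k div 3) \<in> carrier R - {\<zero>}" by simp
  ultimately show "z \<in> {x [^] (3 :: nat) | x. x \<in> carrier R - {\<zero>}}" by blast
qed

lemma card_class:
  assumes "i < 3"
  shows "card {z \<in> carrier R - {\<zero>}. \<kappa> z = i} = m"
proof -
  have "{z \<in> carrier R - {\<zero>}. \<kappa> z = i} = (\<lambda>t. g [^] (3 * t + i)) ` {..<m}"
  proof (intro equalityI subsetI)
    fix z assume z: "z \<in> {z \<in> carrier R - {\<zero>}. \<kappa> z = i}"
    then obtain k where k: "k < 3 * m" "z = g [^] k" by (auto elim: nonzero_pow)
    then have "k mod 3 = i" using z by (simp add: \<kappa>_pow)
    then obtain t where t: "k = 3 * t + i" by (metis mod_div_decomp mult.commute)
    then have "t < m" using k(1) by simp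
    then show "z \<in> (\<lambda>t. g [^] (3 * t + i)) ` {..<m}" using k(2) t by blast
  qed (use assms in \<open>auto simp: \<kappa>_pow\<close>)
  moreover have "inj_on (\<lambda>t. g [^] (3 * t + i)) {..<m}"
    using assms by (auto simp: inj_on_def g_pow_eq_iff)
  ultimately show ?thesis by (simp add: card_image)
qed

section \<open>Cyclotomic numbers of order three and their symmetries\<close>

definition units1 :: "'a set" where
  "units1 = carrier R - {\<zero>, \<one>}"

text \<open>The cardinalities are the cyclotomic numbers. The classical ones use \<open>z\<close>
  and \<open>z \<oplus> \<one>\<close>; the substitution of \<open>\<ominus> z\<close> identifies
  the two versions because -1 is a cube.\<close>

definition cyc :: "nat \<Rightarrow> nat \<Rightarrow> 'a set" where
  "cyc i j = {z \<in> units1. \<kappa> z = i \<and> \<kappa> (\<one> \<ominus> z) = j}"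

lemma finite_units1 [simp]: "finite units1"
  by (simp add: units1_def)

lemma finite_cyc [simp]: "finite (cyc i j)"
  by (simp add: cyc_def)

lemma card_units1: "card units1 = 3 * m - 1"
  using card_Diff_subset[of "{\<zero>, \<one>}" "carrier R"] card_carrier by (simp add: units1_def)

lemma units1D:
  assumes "z \<in> units1"
  shows "z \<in> carrier R" "z \<noteq> \<zero>" "z \<noteq> \<one>"
  using assms by (auto simp: units1_def)

lemma one_minus_units1:
  assumes "z \<in> units1"
  shows "\<one> \<ominus> z \<in> units1" "\<one> \<ominus> (\<one> \<ominus> z) = z"
proof -
  have z: "z \<in> carrier R" "z \<noteq> \<zero>" "z \<noteq> \<one>" using assms by (auto simp: units1_def)
  show inv: "\<one> \<ominus> (\<one> \<ominus> z) = z" using z(1) by algebra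
  have "\<one> \<ominus> z \<noteq> \<zero>" using z by simp
  moreover have "\<one> \<ominus> z \<noteq> \<one>" using inv z by (metis one_closed r_right_minus_eq)
  ultimately show "\<one> \<ominus> z \<in> units1" using z by (simp add: units1_def)
qed

lemma inv_units1:
  assumes "z \<in> units1"
  shows "inv z \<in> units1" "inv (inv z) = z" "\<one> \<ominus> inv z = \<ominus> (inv z \<otimes> (\<one> \<ominus> z))"
proof -
  have z: "z \<in> carrier R" "z \<noteq> \<zero>" "z \<noteq> \<one>" using assms by (auto simp: units1_def)
  then have U: "z \<in> Units R" by (simp add: field_Units)
  have iz: "inv z \<in> carrier R" "inv z \<noteq> \<zero>" "inv z \<otimes> z = \<one>" using U field_Units by auto
  show "inv (inv z) = z" using U by simp
  then show "inv z \<in> units1" using iz z by (auto simp: units1_def)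
  have "\<ominus> (inv z \<otimes> (\<one> \<ominus> z)) = inv z \<otimes> z \<ominus> inv z" using z(1) iz(1) by algebra
  then show "\<one> \<ominus> inv z = \<ominus> (inv z \<otimes> (\<one> \<ominus> z))" using iz by simp
qed

lemma card_cyc_commute: "card (cyc i j) = card (cyc j i)"
  by (rule bij_betw_same_card[of "\<lambda>z. \<one> \<ominus> z"], rule bij_betw_byWitness[where f' = "\<lambda>z. \<one> \<ominus> z"])
    (auto simp: cyc_def one_minus_units1)

text \<open>From \<open>1 - 1/z = - (1/z) (1 - z)\<close> the indices \<open>(i, j)\<close> become
  \<open>(- i, j - i)\<close>; modulo 3 the negative of \<open>i\<close> is written as
  \<open>2 * i\<close>.\<close>

lemma cyc_inv:
  assumes "z \<in> cyc i j"
  shows "inv z \<in> cyc ((2 * i) mod 3) ((2 * i + j) mod 3)"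
proof -
  have z: "z \<in> units1" "\<kappa> z = i" "\<kappa> (\<one> \<ominus> z) = j" using assms by (auto simp: cyc_def)
  note D = units1D[OF z(1)] units1D[OF inv_units1(1)[OF z(1)]] units1D[OF one_minus_units1(1)[OF z(1)]]
  have "\<kappa> (\<one> \<ominus> inv z) = (2 * i + j) mod 3"
    using inv_units1[OF z(1)] D z by (simp add: \<kappa>_minus \<kappa>_mult \<kappa>_inv integral_iff mod_simps)
  then show ?thesis using inv_units1[OF z(1)] D z by (simp add: cyc_def \<kappa>_inv)
qed

lemma card_cyc_inv:
  assumes "i < 3" "j < 3"
  shows "card (cyc i j) = card (cyc ((2 * i) mod 3) ((2 * i + j) mod 3))"
proof (rule bij_betw_same_card[of "\<lambda>z. inv z"], rule bij_betw_byWitness[where f' = "\<lambda>z. inv z"])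
  show "(\<lambda>z. inv z) ` cyc i j \<subseteq> cyc ((2 * i) mod 3) ((2 * i + j) mod 3)"
    using cyc_inv by blast
  have i: "i = 0 \<or> i = 1 \<or> i = 2" and j: "j = 0 \<or> j = 1 \<or> j = 2" using assms by linarith+
  then have "2 * (2 * i mod 3) mod 3 = i" "(2 * (2 * i mod 3) + (2 * i + j) mod 3) mod 3 = j" by auto
  then show "(\<lambda>z. inv z) ` cyc ((2 * i) mod 3) ((2 * i + j) mod 3) \<subseteq> cyc i j"
    using cyc_inv[of _ "(2 * i) mod 3" "(2 * i + j) mod 3"] by auto
qed (auto simp: cyc_def inv_units1)

text \<open>The involutions \<open>z -> 1 - z\<close> and \<open>z -> 1/z\<close> leave four orbits
  of index pairs, represented by 00, 01, 02 and 12.\<close>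

lemma card_cyc_eqs:
  "card (cyc 1 0) = card (cyc 0 1)" "card (cyc 2 2) = card (cyc 0 1)"
  "card (cyc 2 0) = card (cyc 0 2)" "card (cyc 1 1) = card (cyc 0 2)"
  "card (cyc 2 1) = card (cyc 1 2)"
  using card_cyc_commute[of 1 0] card_cyc_commute[of 2 0] card_cyc_commute[of 2 1]
    card_cyc_inv[of 1 0] card_cyc_inv[of 2 0]
  by (simp_all add: numeral_2_eq_2)

text \<open>Class 0 contains \<open>\<one>\<close>, which \<open>units1\<close> omits.\<close>

lemma card_units1_class:
  assumes "i < 3"
  shows "card {z \<in> units1. \<kappa> z = i} = (if i = 0 then m - 1 else m)"
proof -
  have "{z \<in> units1. \<kappa> z = i} = {z \<in> carrier R - {\<zero>}. \<kappa> z = i} - (if i = 0 then {\<one>} else {})"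
    by (auto simp: units1_def)
  then show ?thesis using card_class[OF assms] by (auto simp: card_Diff_singleton_if)
qed

lemma card_cyc_row:
  assumes "i < 3"
  shows "card (cyc i 0) + card (cyc i 1) + card (cyc i 2) = (if i = 0 then m - 1 else m)"
proof -
  have "{z \<in> units1. \<kappa> z = i} = cyc i 0 \<union> cyc i 1 \<union> cyc i 2"
    unfolding cyc_def using \<kappa>_values by blast
  then have "card {z \<in> units1. \<kappa> z = i} = card (cyc i 0 \<union> cyc i 1 \<union> cyc i 2)" by simp
  also have "\<dots> = card (cyc i 0) + card (cyc i 1) + card (cyc i 2)"
    by (subst card_Un_disjoint; (subst card_Un_disjoint)?) (auto simp: cyc_def)
  finally show ?thesis using card_units1_class[OF assms] by simp
qed

section \<open>The cubic character and its Jacobi sum\<close>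

definition \<chi> :: "'a \<Rightarrow> complex" where
  "\<chi> z = \<omega> ^ \<kappa> z"

lemma \<chi>_mult:
  assumes "x \<in> carrier R" "x \<noteq> \<zero>" "y \<in> carrier R" "y \<noteq> \<zero>"
  shows "\<chi> (x \<otimes> y) = \<chi> x * \<chi> y"
  using \<kappa>_mult[OF assms] by (simp add: \<chi>_def \<omega>_power_mod power_add)

lemma \<chi>_divide:
  assumes "x \<in> carrier R" "x \<noteq> \<zero>" "y \<in> carrier R" "y \<noteq> \<zero>"
  shows "\<chi> (x \<otimes> inv y) = \<chi> x * cnj (\<chi> y)"
proof -
  have "inv y \<in> carrier R" "inv y \<noteq> \<zero>" using assms field_Units by auto
  then show ?thesis
    using \<chi>_mult[of x "inv y"] \<kappa>_inv[of y] assms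
    by (simp add: \<chi>_def cnj_\<omega>_power[symmetric] \<omega>_power_mod del: complex_cnj_power)
qed

lemma \<chi>_mult_cnj: "\<chi> x * cnj (\<chi> x) = 1"
proof -
  have "\<chi> x * cnj (\<chi> x) = (\<omega> ^ 3) ^ \<kappa> x"
    unfolding \<chi>_def cnj_\<omega>_power power_mult[symmetric] power_add[symmetric] by simp
  then show ?thesis by (simp add: \<omega>_cube)
qed

lemma sum_units1_\<kappa>:
  "(\<Sum>z\<in>units1. f (\<kappa> z)) = (of_nat m - 1) * f 0 + of_nat m * f 1 + of_nat m * (f 2 :: complex)"
proof -
  have "(\<Sum>z\<in>units1. f (\<kappa> z)) = (\<Sum>i\<in>{..<3}. \<Sum>z\<in>{z \<in> units1. \<kappa> z = i}. f (\<kappa> z))"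
    by (rule sum.group[symmetric]) (use \<kappa>_less in auto)
  also have "\<dots> = (\<Sum>i\<in>{..<3}. of_nat (if i = 0 then m - 1 else m) * f i)"
    by (intro sum.cong refl) (simp add: card_units1_class)
  also have "\<dots> = (of_nat m - 1) * f 0 + of_nat m * f 1 + of_nat m * f 2"
    using m_pos by (simp add: numeral_3_eq_3 numeral_2_eq_2 of_nat_diff)
  finally show ?thesis .
qed

text \<open>The Jacobi sum of \<open>\<chi>\<close> with itself. The arguments 0 and 1 are left out
  since \<open>\<chi>\<close> has an arbitrary value at zero; with the usual value 0 there, they
  would contribute nothing.\<close>

definition jacobi :: complex where
  "jacobi = (\<Sum>z\<in>units1. \<chi> z * \<chi> (\<one> \<ominus> z))"

text \<open>The off-diagonal part of the double sum for the squared norm is parametrized by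
  \<open>s = z / w\<close> and \<open>t = (1 - z) / (1 - w)\<close>, which permutes the pairs of distinct elements of
  \<open>units1\<close>.\<close>

lemma jacobi_norm: "jacobi * cnj jacobi = of_nat (3 * m + 1)"
proof -
  define D where "D = {(z, w) \<in> units1 \<times> units1. z \<noteq> w}"
  define \<phi> where "\<phi> = (\<lambda>(z, w). (z \<otimes> inv w, (\<one> \<ominus> z) \<otimes> inv (\<one> \<ominus> w)))"
  have finD: "finite D" unfolding D_def by (rule finite_subset[of _ "units1 \<times> units1"]) auto
  have split: "units1 \<times> units1 = D \<union> (\<lambda>z. (z, z)) ` units1" "D \<inter> (\<lambda>z. (z, z)) ` units1 = {}"
    by (auto simp: D_def)
  have sum_split: "(\<Sum>z\<in>units1. \<Sum>w\<in>units1. F z w) = (\<Sum>(z, w)\<in>D. F z w) + (\<Sum>z\<in>units1. F z z)"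
    for F :: "'a \<Rightarrow> 'a \<Rightarrow> complex"
  proof -
    have "(\<Sum>z\<in>units1. \<Sum>w\<in>units1. F z w) = (\<Sum>(z, w)\<in>units1 \<times> units1. F z w)"
      by (simp add: sum.cartesian_product)
    also have "\<dots> = (\<Sum>(z, w)\<in>D. F z w) + (\<Sum>(z, w)\<in>(\<lambda>z. (z, z)) ` units1. F z w)"
      unfolding split(1) by (rule sum.union_disjoint) (use finD split(2) in auto)
    also have "(\<Sum>(z, w)\<in>(\<lambda>z. (z, z)) ` units1. F z w) = (\<Sum>z\<in>units1. F z z)"
      by (subst sum.reindex) (auto simp: inj_on_def)
    finally show ?thesis .
  qed
  have quot: "x \<otimes> inv y \<in> units1" "(x \<otimes> inv y) \<otimes> y = x"
    if "x \<in> units1" "y \<in> units1" "x \<noteq> y" for x y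
  proof -
    note D = units1D[OF that(1)] units1D[OF that(2)] units1D[OF inv_units1(1)[OF that(2)]]
    have U: "y \<in> Units R" using D by (simp add: field_Units)
    show *: "(x \<otimes> inv y) \<otimes> y = x" using D U by (simp add: m_assoc)
    then show "x \<otimes> inv y \<in> units1" using D that(3) by (auto simp: units1_def integral_iff)
  qed
  \<comment> \<open>Eliminating \<open>z\<close> from the two defining equations. This shows
    \<open>s \<noteq> t\<close>, and then that \<open>s\<close> and \<open>t\<close> determine
    \<open>w\<close>.\<close>
  have lin: "(s \<ominus> t) \<otimes> w = \<one> \<ominus> t"
    if "s \<in> carrier R" "t \<in> carrier R" "w \<in> carrier R" "s \<otimes> w = z" "t \<otimes> (\<one> \<ominus> w) = \<one> \<ominus> z"
    for s t w z
  proof -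
    have "(s \<ominus> t) \<otimes> w = s \<otimes> w \<oplus> t \<otimes> (\<one> \<ominus> w) \<ominus> t" using that(1-3) by algebra
    also have "\<dots> = z \<oplus> (\<one> \<ominus> z) \<ominus> t" using that(4,5) by simp
    also have "\<dots> = \<one> \<ominus> t" using that(1-4) m_closed[OF that(1,3)] by algebra
    finally show ?thesis .
  qed
  have \<phi>_D: "(s, t) \<in> D \<and> s \<otimes> w = z \<and> t \<otimes> (\<one> \<ominus> w) = \<one> \<ominus> z"
    if zw: "(z, w) \<in> D" and st: "\<phi> (z, w) = (s, t)" for z w s t
  proof -
    have U: "z \<in> units1" "w \<in> units1" "z \<noteq> w" using zw by (auto simp: D_def)
    have s: "s \<in> units1" "s \<otimes> w = z" using quot[OF U] st by (auto simp: \<phi>_def)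
    have "\<one> \<ominus> z \<noteq> \<one> \<ominus> w" using U one_minus_units1(2) by metis
    then have t: "t \<in> units1" "t \<otimes> (\<one> \<ominus> w) = \<one> \<ominus> z"
      using quot[OF one_minus_units1(1)[OF U(1)] one_minus_units1(1)[OF U(2)]] st by (auto simp: \<phi>_def)
    note D = units1D[OF s(1)] units1D[OF t(1)] units1D[OF U(2)]
    have eq: "(s \<ominus> t) \<otimes> w = \<one> \<ominus> t" using lin s(2) t(2) D by blast
    have "s \<noteq> t"
    proof
      assume "s = t"
      then have "s \<ominus> t = \<zero>" using D by simp
      then have "\<one> \<ominus> t = \<zero>" using eq D by (metis l_null)
      then show False using D by simp
    qed
    then show ?thesis using s t by (simp add: D_def)
  qed
  have "inj_on \<phi> D"
  proof (rule inj_onI, clarify)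
    fix z w z' w' assume D1: "(z, w) \<in> D" and D2: "(z', w') \<in> D" and eq: "\<phi> (z, w) = \<phi> (z', w')"
    obtain s t where st: "\<phi> (z, w) = (s, t)" by fastforce
    note 1 = \<phi>_D[OF D1 st] and 2 = \<phi>_D[OF D2 st[unfolded eq]]
    have C: "s \<in> carrier R" "t \<in> carrier R" "s \<noteq> t" "w \<in> carrier R" "w' \<in> carrier R"
      using 1 D1 D2 by (auto simp: D_def units1_def)
    have "(s \<ominus> t) \<otimes> w = (s \<ominus> t) \<otimes> w'"
      using lin[OF C(1,2,4), of z] lin[OF C(1,2,5), of z'] 1 2 by simp
    moreover have "s \<ominus> t \<noteq> \<zero>" "s \<ominus> t \<in> carrier R" using C by auto
    ultimately have "w = w'" using C m_lcancel by blast
    then show "z = z' \<and> w = w'" using 1 2 by simp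
  qed
  moreover have "\<phi> ` D \<subseteq> D" using \<phi>_D by (metis image_subsetI surj_pair)
  ultimately have bij: "bij_betw \<phi> D D" using finD endo_inj_surj by (metis bij_betw_def)
  define T where "T = (\<Sum>(z, w)\<in>D. \<chi> z * \<chi> w)"
  have "jacobi * cnj jacobi
      = (\<Sum>z\<in>units1. \<Sum>w\<in>units1. (\<chi> z * \<chi> (\<one> \<ominus> z)) * cnj (\<chi> w * \<chi> (\<one> \<ominus> w)))"
    by (simp add: jacobi_def sum_product)
  also have "\<dots> = (\<Sum>(z, w)\<in>D. (\<chi> z * \<chi> (\<one> \<ominus> z)) * cnj (\<chi> w * \<chi> (\<one> \<ominus> w))) + (\<Sum>z\<in>units1. 1)"
    unfolding sum_split
  proof (intro arg_cong2[of _ _ _ _ "(+)"] sum.cong refl)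
    fix z
    have "\<chi> z * \<chi> (\<one> \<ominus> z) * cnj (\<chi> z * \<chi> (\<one> \<ominus> z))
        = (\<chi> z * cnj (\<chi> z)) * (\<chi> (\<one> \<ominus> z) * cnj (\<chi> (\<one> \<ominus> z)))" by (simp add: mult_ac)
    then show "\<chi> z * \<chi> (\<one> \<ominus> z) * cnj (\<chi> z * \<chi> (\<one> \<ominus> z)) = 1" by (simp add: \<chi>_mult_cnj)
  qed
  also have "(\<Sum>(z, w)\<in>D. (\<chi> z * \<chi> (\<one> \<ominus> z)) * cnj (\<chi> w * \<chi> (\<one> \<ominus> w)))
      = (\<Sum>v\<in>D. (\<lambda>(s, t). \<chi> s * \<chi> t) (\<phi> v))"
  proof (rule sum.cong, rule refl, clarify)
    fix z w assume "(z, w) \<in> D"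
    then have U: "z \<in> units1" "w \<in> units1" by (auto simp: D_def)
    note D = units1D[OF U(1)] units1D[OF U(2)] units1D[OF one_minus_units1(1)[OF U(1)]]
      units1D[OF one_minus_units1(1)[OF U(2)]]
    show "(\<chi> z * \<chi> (\<one> \<ominus> z)) * cnj (\<chi> w * \<chi> (\<one> \<ominus> w)) = (case \<phi> (z, w) of (s, t) \<Rightarrow> \<chi> s * \<chi> t)"
      using D by (simp add: \<phi>_def \<chi>_divide)
  qed
  also have "\<dots> = T"
    unfolding T_def by (rule sum.reindex_bij_betw[OF bij])
  finally have 1: "jacobi * cnj jacobi = T + of_nat (3 * m - 1)" by (simp add: card_units1)
  have s1: "(\<Sum>z\<in>units1. \<chi> z) = - 1"
  proof -
    have "(\<Sum>z\<in>units1. \<chi> z) = of_nat m * (1 + \<omega> + \<omega> ^ 2) - 1"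
      unfolding \<chi>_def sum_units1_\<kappa>[of "\<lambda>i. \<omega> ^ i"] by (simp add: algebra_simps)
    then show ?thesis by (simp add: \<omega>_sum)
  qed
  have s2: "(\<Sum>z\<in>units1. \<chi> z * \<chi> z) = - 1"
  proof -
    have 4: "\<omega> ^ 2 * \<omega> ^ 2 = \<omega>" using \<omega>_power_mod[of 4] by (simp flip: power_add)
    have "(\<Sum>z\<in>units1. \<chi> z * \<chi> z) = of_nat m * (1 + \<omega> + \<omega> ^ 2) - 1"
      unfolding \<chi>_def sum_units1_\<kappa>[of "\<lambda>i. \<omega> ^ i * \<omega> ^ i"] 4 by (simp add: algebra_simps power2_eq_square)
    then show ?thesis by (simp add: \<omega>_sum)
  qed
  \<comment> \<open>The full double sum is 1 and its diagonal is -1, so \<open>T = 2\<close>; with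
    the \<open>3 * m - 1\<close> diagonal terms of the norm this makes
    \<open>3 * m + 1\<close>.\<close>
  have "(- 1) * (- 1) = (\<Sum>z\<in>units1. \<Sum>w\<in>units1. \<chi> z * \<chi> w)"
    unfolding sum_product[symmetric] s1 ..
  then have "T = 2" using s2 by (simp add: sum_split T_def)
  then show ?thesis using 1 m_pos by (simp add: of_nat_diff)
qed

text \<open>For \<open>e < 3\<close>, the set on which the summand of \<open>jacobi\<close> equals
  \<open>\<omega> ^ e\<close>.\<close>

definition jac_class :: "nat \<Rightarrow> 'a set" where
  "jac_class e = {z \<in> units1. (\<kappa> z + \<kappa> (\<one> \<ominus> z)) mod 3 = e}"

lemma finite_jac_class [simp]: "finite (jac_class e)"
  by (simp add: jac_class_def)

text \<open>For \<open>e = 1\<close> and \<open>e = 2\<close> the three index pairs with sum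
  \<open>e\<close> form one orbit of the symmetries. Hence the factor 3, the source of the 27 in the
  norm equation.\<close>

lemma card_jac_class:
  "card (jac_class 0) = card (cyc 0 0) + 2 * card (cyc 1 2)"
  "card (jac_class 1) = 3 * card (cyc 0 1)"
  "card (jac_class 2) = 3 * card (cyc 0 2)"
proof -
  have mod3: "(\<kappa> x + \<kappa> y) mod 3 = e \<longleftrightarrow> (\<kappa> x, \<kappa> y) \<in> (if e = 0 then {(0, 0), (1, 2), (2, 1)}
      else if e = 1 then {(0, 1), (1, 0), (2, 2)} else {(0, 2), (2, 0), (1, 1)})" if "e < 3" for x y e
    using \<kappa>_values[of x] \<kappa>_values[of y] that by (auto dest: dvd_imp_le)
  have "jac_class 0 = cyc 0 0 \<union> cyc 1 2 \<union> cyc 2 1"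
    "jac_class 1 = cyc 0 1 \<union> cyc 1 0 \<union> cyc 2 2"
    "jac_class 2 = cyc 0 2 \<union> cyc 2 0 \<union> cyc 1 1"
    by (auto simp: jac_class_def cyc_def mod3)
  moreover have "card (cyc i j \<union> cyc i' j' \<union> cyc i'' j'') = card (cyc i j) + card (cyc i' j') + card (cyc i'' j'')"
    if "i \<noteq> i'" "i \<noteq> i''" "i' \<noteq> i''" for i j i' j' i'' j''
    using that by (subst card_Un_disjoint; (subst card_Un_disjoint)?) (auto simp: cyc_def)
  ultimately show "card (jac_class 0) = card (cyc 0 0) + 2 * card (cyc 1 2)"
    "card (jac_class 1) = 3 * card (cyc 0 1)" "card (jac_class 2) = 3 * card (cyc 0 2)"
    by (simp_all add: card_cyc_eqs[simplified])
qed

lemma jacobi_eq: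
  "jacobi = of_int (int (card (jac_class 0)) - int (card (jac_class 2)))
    + of_int (int (card (jac_class 1)) - int (card (jac_class 2))) * \<omega>"
proof -
  have "jacobi = (\<Sum>z\<in>units1. \<omega> ^ ((\<kappa> z + \<kappa> (\<one> \<ominus> z)) mod 3))"
    by (simp add: jacobi_def \<chi>_def \<omega>_power_mod power_add)
  also have "\<dots> = (\<Sum>e\<in>{..<3}. \<Sum>z\<in>{z \<in> units1. (\<kappa> z + \<kappa> (\<one> \<ominus> z)) mod 3 = e}.
      \<omega> ^ ((\<kappa> z + \<kappa> (\<one> \<ominus> z)) mod 3))"
    by (rule sum.group[symmetric]) auto
  also have "\<dots> = (\<Sum>e\<in>{..<3}. of_nat (card (jac_class e)) * \<omega> ^ e)"
    by (intro sum.cong refl) (simp add: jac_class_def)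
  also have "\<dots> = of_nat (card (jac_class 0)) + of_nat (card (jac_class 1)) * \<omega> + of_nat (card (jac_class 2)) * \<omega> ^ 2"
    by (simp add: numeral_3_eq_3 numeral_2_eq_2)
  also have "\<omega> ^ 2 = - 1 - \<omega>" using \<omega>_sum by (simp add: eq_neg_iff_add_eq_0 algebra_simps)
  finally show ?thesis by (simp add: algebra_simps)
qed

text \<open>The squared absolute value of the Jacobi sum, read as an Eisenstein norm and pulled back
  to the integers.\<close>

lemma jac_class_norm:
  fixes a b :: int
  assumes "a = int (card (jac_class 0)) - int (card (jac_class 2))"
    and "b = int (card (jac_class 1)) - int (card (jac_class 2))"
  shows "a ^ 2 - a * b + b ^ 2 = int (order R)"
proof -
  have "(of_int (a ^ 2 - a * b + b ^ 2) :: complex) = of_int (int (order R))"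
    using jacobi_norm unfolding jacobi_eq assms[symmetric] norm_\<omega>_combination order_eq by simp
  then show ?thesis by (simp only: of_int_eq_iff)
qed

subsection \<open>The Jacobi sum modulo the characteristic\<close>

text \<open>The canonical map from the integers; congruences modulo the characteristic become
  equations in the field.\<close>

abbreviation emb :: "int \<Rightarrow> 'a" where
  "emb n \<equiv> [n] \<cdot> \<one>"

lemma emb_closed [simp]: "emb n \<in> carrier R"
  by (rule add.int_pow_closed) simp

lemma emb_diff: "emb (n - k) = emb n \<ominus> emb k"
  unfolding a_minus_def by (rule add.int_pow_diff) simp

lemma emb_mult: "emb (n * k) = emb n \<otimes> emb k"
  by (simp add: add_pow_ldistr_int add.int_pow_pow mult.commute)

lemma emb_0: "emb 0 = \<zero>"
  using emb_diff[of 0 0] by (simp add: a_minus_def r_neg)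

lemma emb_order: "emb (int (order R)) = \<zero>"
proof -
  have "[order R] \<cdot> \<one> = \<zero>"
    using add.pow_order_eq_1[of \<one>] by (simp add: order_def)
  then show ?thesis by (simp add: add_pow_def int_pow_int)
qed

text \<open>For \<open>a = b = 2 * m\<close> this is the Jacobi sum with \<open>\<omega>\<close>
  replaced by \<open>(g [^] m) [^] 2\<close>. General exponents are allowed for the sake of a
  recursion in \<open>b\<close>.\<close>

definition power_sum :: "nat \<Rightarrow> nat \<Rightarrow> 'a" where
  "power_sum a b = (\<Oplus>z\<in>carrier R. z [^] a \<otimes> (\<one> \<ominus> z) [^] b)"

lemma power_sum_closed [simp]: "power_sum a b \<in> carrier R"
  unfolding power_sum_def by (rule finsum_closed) auto

text \<open>One factor \<open>1 - z\<close> is expanded; this recursion produces the binomial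
  coefficients.\<close>

lemma power_sum_Suc: "power_sum a (Suc b) = power_sum a b \<ominus> power_sum (Suc a) b"
proof -
  have "power_sum a (Suc b) \<oplus> power_sum (Suc a) b
      = (\<Oplus>z\<in>carrier R. z [^] a \<otimes> (\<one> \<ominus> z) [^] Suc b \<oplus> z [^] Suc a \<otimes> (\<one> \<ominus> z) [^] b)"
    unfolding power_sum_def by (rule finsum_addf[symmetric]) auto
  also have "\<dots> = power_sum a b"
    unfolding power_sum_def
  proof (rule finsum_cong', rule refl)
    fix z assume z: "z \<in> carrier R"
    define u v where "u = z [^] a" and "v = (\<one> \<ominus> z) [^] b"
    have "u \<in> carrier R" "v \<in> carrier R" using z by (auto simp: u_def v_def)
    then have "u \<otimes> (v \<otimes> (\<one> \<ominus> z)) \<oplus> (u \<otimes> z) \<otimes> v = u \<otimes> v" using z by algebra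
    then show "z [^] a \<otimes> (\<one> \<ominus> z) [^] Suc b \<oplus> z [^] Suc a \<otimes> (\<one> \<ominus> z) [^] b = z [^] a \<otimes> (\<one> \<ominus> z) [^] b"
      by (simp add: u_def v_def)
  qed auto
  finally have "power_sum a b = power_sum a (Suc b) \<oplus> power_sum (Suc a) b" ..
  moreover have "x \<oplus> y \<ominus> y = x" if "x \<in> carrier R" "y \<in> carrier R" for x y
    using that by algebra
  ultimately show ?thesis by simp
qed

lemma power_sum_nonzero:
  assumes "a > 0"
  shows "power_sum a b = (\<Oplus>z\<in>carrier R - {\<zero>}. z [^] a \<otimes> (\<one> \<ominus> z) [^] b)"
proof -
  have "power_sum a b = (\<Oplus>z\<in>insert \<zero> (carrier R - {\<zero>}). z [^] a \<otimes> (\<one> \<ominus> z) [^] b)"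
    unfolding power_sum_def by (simp add: insert_absorb)
  also have "\<dots> = \<zero> [^] a \<otimes> (\<one> \<ominus> \<zero>) [^] b \<oplus> (\<Oplus>z\<in>carrier R - {\<zero>}. z [^] a \<otimes> (\<one> \<ominus> z) [^] b)"
    by (rule finsum_insert) auto
  also have "\<zero> [^] a = \<zero>" using assms by (simp add: nat_pow_zero)
  finally show ?thesis by simp
qed

text \<open>If \<open>3 * m\<close> divides \<open>a\<close>, every nonzero \<open>z\<close>
  contributes 1 and \<open>q - 1\<close> becomes -1. Otherwise the permutation
  \<open>z -> g z\<close> multiplies the sum by \<open>g [^] a\<close>, which is not 1. Positivity
  of \<open>a\<close> removes the term at zero.\<close>

lemma power_sum_0:
  assumes "a > 0"
  shows "power_sum a 0 = (if 3 * m dvd a then \<ominus> \<one> else \<zero>)"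
proof (cases "3 * m dvd a")
  case True
  have "z [^] a = \<one>" if z: "z \<in> carrier R - {\<zero>}" for z
  proof -
    obtain k :: nat where "z = g [^] k" using z by (auto elim: nonzero_pow)
    moreover have "g [^] (k * a) = g [^] (0 :: nat)" using True by (subst g_pow_eq_iff) auto
    ultimately show ?thesis by (simp add: nat_pow_pow)
  qed
  then have "power_sum a 0 = (\<Oplus>z\<in>carrier R - {\<zero>}. \<one>)"
    unfolding power_sum_nonzero[OF assms] by (intro finsum_cong') auto
  also have "\<dots> = [card (carrier R - {\<zero>})] \<cdot> \<one>" by (rule add.finprod_const) simp
  also have "\<dots> = emb (int (order R) - 1)"
    by (simp add: card_carrier order_eq add_pow_def int_pow_int[symmetric])
  also have "\<dots> = \<ominus> \<one>" using emb_order by (simp add: emb_diff a_minus_def)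
  finally show ?thesis using True by simp
next
  case False
  have "g [^] a \<noteq> g [^] (0 :: nat)" using False by (subst g_pow_eq_iff) (auto simp: mod_eq_0_iff_dvd)
  then have ne: "g [^] a \<ominus> \<one> \<noteq> \<zero>" by simp
  have img: "carrier R = (\<lambda>z. g \<otimes> z) ` carrier R"
  proof (rule endo_inj_surj[symmetric])
    show "inj_on (\<lambda>z. g \<otimes> z) (carrier R)" using m_lcancel by (auto simp: inj_on_def)
  qed auto
  have P: "power_sum a 0 = (\<Oplus>z\<in>carrier R. z [^] a)"
    unfolding power_sum_def by (rule finsum_cong') auto
  also have "\<dots> = (\<Oplus>z\<in>(\<lambda>z. g \<otimes> z) ` carrier R. z [^] a)" using img by simp
  also have "\<dots> = (\<Oplus>z\<in>carrier R. (g \<otimes> z) [^] a)"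
    by (rule finsum_reindex) (use m_lcancel in \<open>auto simp: inj_on_def\<close>)
  also have "\<dots> = (\<Oplus>z\<in>carrier R. g [^] a \<otimes> z [^] a)"
    by (rule finsum_cong') (auto simp: nat_pow_distrib)
  also have "\<dots> = g [^] a \<otimes> (\<Oplus>z\<in>carrier R. z [^] a)"
    by (rule finsum_rdistr[symmetric]) auto
  finally have "power_sum a 0 = g [^] a \<otimes> power_sum a 0" using P by simp
  moreover have "(u \<ominus> \<one>) \<otimes> x = u \<otimes> x \<ominus> x" if "u \<in> carrier R" "x \<in> carrier R" for u x
    using that by algebra
  ultimately have "(g [^] a \<ominus> \<one>) \<otimes> power_sum a 0 = \<zero>" by simp
  then have "power_sum a 0 = \<zero>" using ne integral[of "g [^] a \<ominus> \<one>" "power_sum a 0"] by simp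
  then show ?thesis using False by simp
qed

text \<open>Expansion of the second factor yields only exponents strictly between
  \<open>3 * m\<close> and \<open>6 * m\<close>, none divisible by \<open>3 * m\<close>.\<close>

lemma power_sum_eq_0:
  "3 * m < a \<Longrightarrow> a + b < 6 * m \<Longrightarrow> power_sum a b = \<zero>"
proof (induction b arbitrary: a)
  case 0
  have "\<not> 3 * m dvd a"
  proof
    assume "3 * m dvd a"
    then obtain k where k: "a = 3 * m * k" ..
    then have "1 < k" "k < 2" using 0 m_pos by (auto intro: ccontr)
    then show False by simp
  qed
  then show ?case using power_sum_0[of a] 0 by simp
next
  case (Suc b)
  then show ?case by (simp add: power_sum_Suc)
qed

text \<open>In the expansion of \<open>(1 - z) ^ b\<close> only the total exponent
  \<open>3 * m\<close> survives. It comes from the term \<open>z ^ k\<close> with coefficient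
  \<open>(- 1) ^ k (b choose k)\<close>, and its power sum is -1. The induction is Pascal's
  rule.\<close>

lemma power_sum_binomial:
  "k < 3 * m \<Longrightarrow> 3 * m - k + b < 6 * m \<Longrightarrow> power_sum (3 * m - k) b = emb (- ((- 1) ^ k * int (b choose k)))"
proof (induction b arbitrary: k)
  case 0
  have "3 * m dvd 3 * m - k \<longleftrightarrow> k = 0"
    using 0 m_pos by (auto dest: dvd_imp_le)
  moreover have "emb (- 1) = \<ominus> \<one>" using emb_diff[of 0 1] by (simp add: a_minus_def emb_0)
  ultimately show ?case using power_sum_0[of "3 * m - k"] 0 by (cases k) (auto simp: emb_0)
next
  case (Suc b)
  show ?case
  proof (cases k)
    case 0
    \<comment> \<open>For \<open>k = 0\<close> the second sum of the recursion starts above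
      \<open>3 * m\<close> and vanishes.\<close>
    then show ?thesis
      using Suc.IH[of 0] Suc.prems power_sum_eq_0[of "Suc (3 * m)" b] by (simp add: power_sum_Suc a_minus_def)
  next
    case (Suc j)
    then have j: "Suc (3 * m - k) = 3 * m - j" "j < 3 * m" using Suc.prems by auto
    have "power_sum (3 * m - k) (Suc b) = emb (- ((- 1) ^ k * int (b choose k))) \<ominus> emb (- ((- 1) ^ j * int (b choose j)))"
      unfolding power_sum_Suc j(1) using Suc.IH[of k] Suc.IH[of j] Suc.prems Suc by simp
    also have "\<dots> = emb (- ((- 1) ^ k * int (b choose k)) - (- ((- 1) ^ j * int (b choose j))))"
      by (rule emb_diff[symmetric])
    also have "- ((- 1) ^ k * int (b choose k)) - (- ((- 1) ^ j * int (b choose j))) = - ((- 1) ^ k * int (Suc b choose k))"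
      using Suc by (simp add: algebra_simps)
    finally show ?thesis .
  qed
qed

text \<open>With \<open>\<theta> = g [^] m\<close>, the summand is constant on each
  \<open>jac_class e\<close>, with value \<open>\<theta>\<close> to the power \<open>2 * e\<close>
  modulo 3. The terms at 0 and 1 vanish because \<open>m > 0\<close>.\<close>

lemma power_sum_jac_class:
  "power_sum (2 * m) (2 * m) = emb (int (card (jac_class 0)))
    \<oplus> emb (int (card (jac_class 1))) \<otimes> (g [^] m) [^] (2 :: nat) \<oplus> emb (int (card (jac_class 2))) \<otimes> (g [^] m)"
proof -
  let ?f = "\<lambda>z. z [^] (2 * m) \<otimes> (\<one> \<ominus> z) [^] (2 * m)"
  have carr: "carrier R - {\<zero>} = insert \<one> units1" "\<one> \<notin> units1" by (auto simp: units1_def)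
  have U: "units1 \<subseteq> carrier R" by (auto simp: units1_def)
  have "power_sum (2 * m) (2 * m) = finsum R ?f (insert \<one> units1)"
    using power_sum_nonzero[of "2 * m" "2 * m"] m_pos carr by simp
  also have "\<dots> = ?f \<one> \<oplus> finsum R ?f units1"
    by (rule finsum_insert) (use carr U in auto)
  also have "?f \<one> = \<zero>" using m_pos by (simp add: nat_pow_zero a_minus_def r_neg)
  also have "finsum R ?f units1 = finsum R ?f (jac_class 0 \<union> (jac_class 1 \<union> jac_class 2))"
  proof -
    have "units1 = jac_class 0 \<union> (jac_class 1 \<union> jac_class 2)"
      by (auto simp: jac_class_def)
    then show ?thesis by simp
  qed
  also have "\<dots> = finsum R ?f (jac_class 0) \<oplus> (finsum R ?f (jac_class 1) \<oplus> finsum R ?f (jac_class 2))"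
    by (subst finsum_Un_disjoint; (subst finsum_Un_disjoint)?) (use U in \<open>auto simp: jac_class_def\<close>)
  finally have split: "power_sum (2 * m) (2 * m) = \<zero> \<oplus> (finsum R ?f (jac_class 0) \<oplus> (finsum R ?f (jac_class 1) \<oplus> finsum R ?f (jac_class 2)))" .
  have val: "finsum R ?f (jac_class e) = emb (int (card (jac_class e))) \<otimes> (g [^] m) [^] ((2 * e) mod 3)"
    for e :: nat
  proof -
    have "?f z = (g [^] m) [^] ((2 * e) mod 3)" if "z \<in> jac_class e" for z
    proof -
      have z: "z \<in> units1" and e: "(\<kappa> z + \<kappa> (\<one> \<ominus> z)) mod 3 = e" using that by (auto simp: jac_class_def)
      note D = units1D[OF z] units1D[OF one_minus_units1(1)[OF z]]
      have "?f z = (z [^] m) [^] (2 :: nat) \<otimes> ((\<one> \<ominus> z) [^] m) [^] (2 :: nat)"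
        using D by (simp add: nat_pow_pow mult.commute)
      also have "\<dots> = g [^] (m * (2 * (\<kappa> z + \<kappa> (\<one> \<ominus> z))))"
        using pow_m[OF D(1,2)] pow_m[OF D(4,5)] by (simp add: nat_pow_pow nat_pow_mult algebra_simps)
      also have "\<dots> = g [^] (m * ((2 * e) mod 3))"
      proof -
        have "(2 * (\<kappa> z + \<kappa> (\<one> \<ominus> z))) mod 3 = (2 * e) mod 3" using e by (metis mod_mult_right_eq)
        then have "(m * (2 * (\<kappa> z + \<kappa> (\<one> \<ominus> z)))) mod (m * 3) = (m * ((2 * e) mod 3)) mod (m * 3)"
          by (simp only: mult_mod_right[symmetric] mod_mod_trivial)
        then show ?thesis by (simp only: g_pow_eq_iff mult.commute[of 3 m])
      qed
      also have "\<dots> = (g [^] m) [^] ((2 * e) mod 3)" by (simp add: nat_pow_pow)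
      finally show ?thesis .
    qed
    then have "finsum R ?f (jac_class e) = (\<Oplus>z\<in>jac_class e. (g [^] m) [^] ((2 * e) mod 3))"
      by (intro finsum_cong') auto
    also have "\<dots> = [card (jac_class e)] \<cdot> ((g [^] m) [^] ((2 * e) mod 3))"
      by (rule add.finprod_const) simp
    also have "\<dots> = [int (card (jac_class e))] \<cdot> ((g [^] m) [^] ((2 * e) mod 3))"
      by (simp add: add_pow_def int_pow_int)
    finally show ?thesis by (simp add: add_pow_ldistr_int)
  qed
  show ?thesis unfolding split val by (simp add: a_assoc)
qed

lemma g_pow_m_sum: "\<one> \<oplus> (g [^] m \<oplus> (g [^] m) [^] (2 :: nat)) = \<zero>"
proof -
  define \<theta> where "\<theta> = g [^] m"
  have \<theta>: "\<theta> \<in> carrier R" by (simp add: \<theta>_def)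
  have "g [^] m \<noteq> g [^] (0 :: nat)" using m_pos by (subst g_pow_eq_iff) auto
  then have ne: "\<theta> \<ominus> \<one> \<noteq> \<zero>" using \<theta> by (simp add: \<theta>_def)
  have "g [^] (m * 3) = g [^] (0 :: nat)" by (subst g_pow_eq_iff) auto
  then have "\<theta> [^] (3 :: nat) = \<one>" by (simp add: \<theta>_def nat_pow_pow)
  then have "\<theta> \<otimes> (\<theta> \<otimes> \<theta>) = \<one>" using \<theta> by (simp add: numeral_3_eq_3 m_assoc)
  moreover have "(\<theta> \<ominus> \<one>) \<otimes> (\<one> \<oplus> (\<theta> \<oplus> \<theta> \<otimes> \<theta>)) = \<theta> \<otimes> (\<theta> \<otimes> \<theta>) \<ominus> \<one>" using \<theta> by algebra
  ultimately have "(\<theta> \<ominus> \<one>) \<otimes> (\<one> \<oplus> (\<theta> \<oplus> \<theta> \<otimes> \<theta>)) = \<zero>" by simp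
  then have "\<one> \<oplus> (\<theta> \<oplus> \<theta> \<otimes> \<theta>) = \<zero>" using integral[of "\<theta> \<ominus> \<one>" "\<one> \<oplus> (\<theta> \<oplus> \<theta> \<otimes> \<theta>)"] ne \<theta> by simp
  then show ?thesis using \<theta> by (simp add: \<theta>_def numeral_2_eq_2)
qed

text \<open>Otherwise the three cardinalities agree modulo \<open>p\<close>, and the power sum is a
  multiple of \<open>1 + \<theta> + \<theta>^2 = 0\<close> for \<open>\<theta> = g [^] m\<close>.
  But up to sign it is the image of a central binomial coefficient prime to
  \<open>p\<close>.\<close>

lemma jac_class_not_cong:
  assumes "prime p" "order R = p ^ l" "[p = 1] (mod 3)"
  shows "\<not> (int p dvd int (card (jac_class 0)) - int (card (jac_class 2)) \<and>
            int p dvd int (card (jac_class 1)) - int (card (jac_class 2)))"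
proof
  assume dvd: "int p dvd int (card (jac_class 0)) - int (card (jac_class 2)) \<and>
            int p dvd int (card (jac_class 1)) - int (card (jac_class 2))"
  \<comment> \<open>The order \<open>p ^ l\<close> annihilates \<open>\<one>\<close>, and a field
    has no nilpotents; so the characteristic is \<open>p\<close>.\<close>
  have emb_p: "emb (int p) = \<zero>"
  proof -
    have "emb (int p ^ k) = emb (int p) [^] k" for k
      by (induction k) (simp_all add: emb_mult m_comm)
    moreover have "int p ^ l = int (order R)" using assms(2) by simp
    ultimately have "emb (int p) [^] l = \<zero>" using emb_order by metis
    then show ?thesis using pow_nonzero[OF emb_closed, of "int p" l] by blast
  qed
  have emb_dvd: "emb n = \<zero>" if "int p dvd n" for n
    using that emb_p by (auto simp: emb_mult)
  have emb_eq: "emb n = emb k" if "int p dvd n - k" for n k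
    using emb_dvd[OF that] by (simp add: emb_diff)
  have "power_sum (2 * m) (2 * m) = emb (int (card (jac_class 2)))
      \<otimes> (\<one> \<oplus> (g [^] m \<oplus> (g [^] m) [^] (2 :: nat)))"
  proof -
    have "e \<oplus> e \<otimes> x \<oplus> e \<otimes> y = e \<otimes> (\<one> \<oplus> (y \<oplus> x))"
      if "e \<in> carrier R" "x \<in> carrier R" "y \<in> carrier R" for e x y
      using that by algebra
    then show ?thesis
      unfolding power_sum_jac_class emb_eq[OF conjunct1[OF dvd]] emb_eq[OF conjunct2[OF dvd]] by simp
  qed
  then have "power_sum (2 * m) (2 * m) = \<zero>" by (simp add: g_pow_m_sum)
  moreover define N where "N = - ((- 1) ^ m * int (2 * m choose m))"
  have "power_sum (2 * m) (2 * m) = emb N"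
    using power_sum_binomial[of m "2 * m"] m_pos by (simp add: N_def)
  ultimately have emb_N: "emb N = \<zero>" by simp
  have "\<not> p dvd (2 * m choose m)"
    by (rule not_dvd_central_binomial[OF assms(1) _ assms(3)]) (use assms(2) order_eq in simp)
  then have "coprime (int (2 * m choose m)) (int p)"
    using prime_imp_coprime[OF assms(1)] coprime_commute coprime_int_iff by blast
  then have "coprime N (int p)" by (simp add: N_def)
  \<comment> \<open>A Bezout relation between \<open>N\<close> and \<open>p\<close>, both mapped to
    zero, would map 1 to zero.\<close>
  then obtain u v where uv: "u * N + v * int p = 1"
    using bezout_int[of N "int p"] by auto
  have "emb (u * N - (- v) * int p) = emb u \<otimes> emb N \<ominus> emb (- v) \<otimes> emb (int p)"
    by (simp only: emb_diff emb_mult)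
  also have "\<dots> = \<zero>" unfolding emb_N emb_p by (simp add: a_minus_def)
  also have "u * N - (- v) * int p = 1" using uv by simp
  finally show False by simp
qed

section \<open>The number of \<open>z\<close> with \<open>z\<close> and \<open>1 - z\<close> both
  nonzero cubes\<close>

lemma card_cyc_00:
  assumes "prime p" "order R = p ^ l" "[p = 1] (mod 3)" "l \<ge> 1"
  obtains c d :: int where "9 * int (card (cyc 0 0)) = c + int p ^ l - 8"
    "c ^ 2 + 27 * d ^ 2 = 4 * int p ^ l" "[c = 1] (mod 3)" "\<not> int p dvd c"
proof -
  define A B C D where "A = int (card (cyc 0 0))" and "B = int (card (cyc 0 1))"
    and "C = int (card (cyc 0 2))" and "D = int (card (cyc 1 2))"
  define a b where "a = int (card (jac_class 0)) - int (card (jac_class 2))"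
    and "b = int (card (jac_class 1)) - int (card (jac_class 2))"
  have ab: "a = A + 2 * D - 3 * C" "b = 3 * (B - C)"
    by (simp_all add: a_def b_def A_def B_def C_def D_def card_jac_class[simplified])
  have rows: "A + B + C = int m - 1" "B + C + D = int m"
    using card_cyc_row[of 0] card_cyc_row[of 1] card_cyc_eqs m_pos
    by (simp_all add: A_def B_def C_def D_def)
  have q: "int p ^ l = 3 * int m + 1" using assms(2) order_eq by (simp flip: of_nat_power)
  have norm: "a ^ 2 - a * b + b ^ 2 = int p ^ l"
    using jac_class_norm[OF a_def b_def] assms(2) by simp
  \<comment> \<open>This is the sum of the Jacobi sum and its conjugate. Four times the norm form is
    \<open>c ^ 2 + 3 * b ^ 2\<close>, and \<open>b\<close> is a multiple of 3.\<close>
  define c where "c = 2 * a - b"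
  have "9 * A = c + int p ^ l - 8" using rows q ab by (simp add: c_def)
  moreover have four: "c ^ 2 + 27 * (B - C) ^ 2 = 4 * int p ^ l"
  proof -
    have "c ^ 2 + 27 * (B - C) ^ 2 = c ^ 2 + 3 * b ^ 2" unfolding ab(2) power_mult_distrib by simp
    also have "\<dots> = 4 * (a ^ 2 - a * b + b ^ 2)" by (simp add: c_def power2_eq_square algebra_simps)
    finally show ?thesis using norm by simp
  qed
  moreover have "[c = 1] (mod 3)"
  proof -
    \<comment> \<open>Subtracting the row equations gives \<open>A = D - 1\<close>, whence
      \<open>c = 6 D - 3 B - 3 C - 2\<close>.\<close>
    have eq: "c - 1 = 3 * (2 * D - 2 * C - 1 - B + C)" using rows ab by (simp add: c_def)
    show ?thesis unfolding cong_iff_dvd_diff eq by simp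
  qed
  moreover have "\<not> int p dvd c"
  proof
    \<comment> \<open>The norm equation passes divisibility by \<open>p\<close> from
      \<open>c\<close> to \<open>b\<close>, and the norm form from \<open>b\<close> to
      \<open>a\<close>, against \<open>jac_class_not_cong\<close>.\<close>
    assume pc: "int p dvd c"
    have pp: "prime (int p)" using assms(1) by simp
    have ndvd3: "\<not> int p dvd 3"
    proof
      assume "int p dvd 3"
      then have "p dvd 3" by (metis int_dvd_int_iff of_nat_numeral)
      then have "p = 2 \<or> p = 3" using dvd_imp_le[of p 3] prime_gt_1_nat[OF assms(1)] by auto
      then show False using assms(3) by (auto simp: cong_def)
    qed
    have "int p dvd 4 * int p ^ l - c ^ 2"
      using pc assms(4) by (intro dvd_diff dvd_mult) (simp_all add: power2_eq_square)
    moreover have "4 * int p ^ l - c ^ 2 = 3 ^ 3 * (B - C) ^ 2" using four by simp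
    ultimately have "int p dvd 3 ^ 3 * (B - C) ^ 2" by simp
    then have "int p dvd B - C"
      using pp ndvd3 prime_dvd_multD prime_dvd_power by metis
    then have pb: "int p dvd b" unfolding ab(2) by (rule dvd_mult)
    have "int p dvd int p ^ l - b * (b - a)" using pb assms(4) by (intro dvd_diff) simp_all
    moreover have "int p ^ l - b * (b - a) = a ^ 2" using norm by (simp add: power2_eq_square algebra_simps)
    ultimately have "int p dvd a" using pp prime_dvd_power by metis
    then show False using jac_class_not_cong[OF assms(1-3)] pb by (simp add: a_def b_def)
  qed
  ultimately show ?thesis using that by (simp add: A_def)
qed

text \<open>The hypotheses make 2 a nonzero cube, so the fixed point 1/2 of
  \<open>z -> 1 - z\<close> lies in \<open>cyc 0 0\<close>; all other elements pair off.\<close>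

lemma odd_card_cyc_00:
  assumes "h \<in> carrier R" "h [^] (3 :: nat) = \<one> \<oplus> \<one>" "\<one> \<oplus> \<one> \<noteq> \<zero>"
  shows "odd (card (cyc 0 0))"
proof -
  define z where "z = inv (\<one> \<oplus> \<one>)"
  have U: "\<one> \<oplus> \<one> \<in> Units R" using assms(3) by (simp add: field_Units)
  have z: "z \<in> carrier R" "z \<otimes> (\<one> \<oplus> \<one>) = \<one>" using U by (auto simp: z_def)
  have z0: "z \<noteq> \<zero>" using z by auto
  have z1: "z \<noteq> \<one>"
  proof
    assume "z = \<one>"
    then have "\<one> \<oplus> \<one> = \<one>" using z by simp
    then show False by (metis add.l_cancel_one' one_closed one_not_zero)
  qed
  have zz: "\<one> \<ominus> z = z"
  proof -
    have "\<one> \<ominus> z = z \<otimes> (\<one> \<oplus> \<one>) \<ominus> z" using z by simp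
    also have "\<dots> = z" using z(1) by algebra
    finally show ?thesis .
  qed
  have "h \<noteq> \<zero>" using assms by (auto simp: nat_pow_zero)
  then have "\<one> \<oplus> \<one> \<in> {z \<in> carrier R - {\<zero>}. \<kappa> z = 0}"
    unfolding cubes_eq[symmetric] using assms(1,2) by force
  then have "\<kappa> z = 0" using \<kappa>_inv[of "\<one> \<oplus> \<one>"] by (simp add: z_def)
  then have mem: "z \<in> cyc 0 0" using z z0 z1 zz by (simp add: cyc_def units1_def)
  have fixpoint: "w = z" if "w \<in> carrier R" "\<one> \<ominus> w = w" for w
  proof -
    have "w \<otimes> (\<one> \<oplus> \<one>) = w \<oplus> w" using that(1) by algebra
    also have "\<dots> = (\<one> \<ominus> w) \<oplus> w" using that(2) by simp
    also have "\<dots> = \<one>" using that(1) by algebra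
    finally have "w \<otimes> (\<one> \<oplus> \<one>) = z \<otimes> (\<one> \<oplus> \<one>)" using z by simp
    then show ?thesis using m_rcancel assms(3) that(1) z(1) by simp
  qed
  have "even (card (cyc 0 0 - {z}))"
  proof (rule even_card_involution[of _ "\<lambda>w. \<one> \<ominus> w"])
    fix w assume w: "w \<in> cyc 0 0 - {z}"
    then have "w \<in> units1" "w \<in> carrier R" by (auto simp: cyc_def units1_def)
    note o = one_minus_units1[OF this(1)]
    show "\<one> \<ominus> (\<one> \<ominus> w) = w" by (rule o)
    show "\<one> \<ominus> w \<noteq> w" using fixpoint[OF \<open>w \<in> carrier R\<close>] w by auto
    have "\<one> \<ominus> w \<noteq> z" using o(2) zz w by auto
    then show "\<one> \<ominus> w \<in> cyc 0 0 - {z}" using w o by (simp add: cyc_def)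
  qed simp
  then show ?thesis using card_Suc_Diff1[OF _ mem] by (metis even_Suc finite_cyc)
qed

end

section \<open>Triangles\<close>

text \<open>Each triangle has 3! orderings. Ordered triangles are what the affine normalization
  counts.\<close>

lemma card_triangle_lists:
  assumes "finite (verts H)"
  shows "card {xs. length xs = 3 \<and> distinct xs \<and> set xs \<in> triangles H} = 6 * num_triangles H"
proof -
  have T: "finite T" "card T = 3" if "T \<in> triangles H" for T
    using that assms by (auto simp: triangles_def intro: finite_subset)
  have fin: "finite (triangles H)"
    by (rule finite_subset[of _ "Pow (verts H)"]) (use assms in \<open>auto simp: triangles_def\<close>)
  have set_eq: "set xs = T" if "T \<in> triangles H" "length xs = 3" "distinct xs" "set xs \<subseteq> T" for T xs
    using that T[OF that(1)] by (metis card_subset_eq distinct_card)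
  have "{xs. length xs = 3 \<and> distinct xs \<and> set xs \<in> triangles H}
      = (\<Union>T\<in>triangles H. {xs. length xs = 3 \<and> distinct xs \<and> set xs \<subseteq> T})"
    using set_eq by blast
  also have "card \<dots> = (\<Sum>T\<in>triangles H. card {xs. length xs = 3 \<and> distinct xs \<and> set xs \<subseteq> T})"
  proof (rule card_UN_disjoint[OF fin])
    show "\<forall>T\<in>triangles H. finite {xs. length xs = 3 \<and> distinct xs \<and> set xs \<subseteq> T}"
      using T(1) by (auto intro: finite_subset[OF _ finite_lists_length_eq[of _ 3]])
    show "\<forall>T\<in>triangles H. \<forall>T'\<in>triangles H. T \<noteq> T' \<longrightarrow>
        {xs. length xs = 3 \<and> distinct xs \<and> set xs \<subseteq> T} \<inter> {xs. length xs = 3 \<and> distinct xs \<and> set xs \<subseteq> T'} = {}"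
      using set_eq by blast
  qed
  also have "\<dots> = (\<Sum>T\<in>triangles H. 6)"
  proof (rule sum.cong, rule refl)
    fix T assume "T \<in> triangles H"
    then show "card {xs. length xs = 3 \<and> distinct xs \<and> set xs \<subseteq> T} = 6"
      using T by (subst card_lists_distinct_length_eq) (auto simp: numeral_eq_Suc)
  qed
  finally show ?thesis by (simp add: num_triangles_def)
qed

context cubic_field
begin

lemma paley_adj_iff:
  "u \<rightarrow>\<^bsub>generalized_paley_graph 3 R\<^esub> v \<longleftrightarrow>
    u \<in> carrier R \<and> v \<in> carrier R \<and> u \<noteq> v \<and> \<kappa> (v \<ominus> u) = 0"
  unfolding generalized_paley_graph_def cayley_graph_def cubes_eq by auto

lemma verts_paley [simp]: "verts (generalized_paley_graph 3 R) = carrier R"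
  by (simp add: generalized_paley_graph_def cayley_graph_def)

lemma \<kappa>_diff_commute:
  assumes "u \<in> carrier R" "v \<in> carrier R" "u \<noteq> v"
  shows "\<kappa> (v \<ominus> u) = \<kappa> (u \<ominus> v)"
proof -
  have "v \<ominus> u = \<ominus> (u \<ominus> v)" using assms by algebra
  then show ?thesis using \<kappa>_minus[of "u \<ominus> v"] assms by simp
qed

text \<open>The affine map taking 0 and 1 to the first two vertices has slope \<open>h\<close>, a
  nonzero cube, and takes \<open>t\<close> to the third. The other two edges are \<open>h t\<close>
  and \<open>h (1 - t)\<close> up to sign, so they ask that \<open>t\<close> and
  \<open>1 - t\<close> be cubes.\<close>

lemma paley_triangle_lists:
  "bij_betw (\<lambda>(u, h, t). [u, u \<oplus> h, u \<oplus> h \<otimes> t])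
    (carrier R \<times> {h \<in> carrier R - {\<zero>}. \<kappa> h = 0} \<times> cyc 0 0)
    {xs. length xs = 3 \<and> distinct xs \<and> set xs \<in> triangles (generalized_paley_graph 3 R)}"
  (is "bij_betw ?f ?A ?L")
proof (rule bij_betwI')
  fix x y assume "x \<in> ?A" "y \<in> ?A"
  moreover obtain u h t where x: "x = (u, h, t)" by (metis prod_cases3)
  moreover obtain u' h' t' where y: "y = (u', h', t')" by (metis prod_cases3)
  ultimately have C: "u \<in> carrier R" "h \<in> carrier R" "h \<noteq> \<zero>" "t \<in> carrier R"
    "u' \<in> carrier R" "h' \<in> carrier R" "t' \<in> carrier R" by (auto simp: cyc_def units1_def)
  show "(?f x = ?f y) = (x = y)" using C by (auto simp: x y m_lcancel)
next
  fix x assume "x \<in> ?A"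
  moreover obtain u h t where x: "x = (u, h, t)" by (metis prod_cases3)
  ultimately have C: "u \<in> carrier R" "h \<in> carrier R" "h \<noteq> \<zero>" "\<kappa> h = 0" and t: "t \<in> units1" "\<kappa> t = 0" "\<kappa> (\<one> \<ominus> t) = 0"
    by (auto simp: cyc_def)
  note D = units1D[OF t(1)] units1D[OF one_minus_units1(1)[OF t(1)]]
  define v w where "v = u \<oplus> h" and "w = u \<oplus> h \<otimes> t"
  have vw: "v \<in> carrier R" "w \<in> carrier R" using C D by (auto simp: v_def w_def)
  have d: "v \<ominus> u = h" "w \<ominus> u = h \<otimes> t" "v \<ominus> w = h \<otimes> (\<one> \<ominus> t)"
    unfolding v_def w_def using C(1,2) D(1) by algebra+
  have "v \<ominus> u \<noteq> \<zero>" "w \<ominus> u \<noteq> \<zero>" "v \<ominus> w \<noteq> \<zero>"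
    unfolding d using C(2,3) D by (simp_all add: integral_iff)
  then have ne: "v \<noteq> u" "w \<noteq> u" "v \<noteq> w" using C(1) vw by auto
  have k: "\<kappa> (v \<ominus> u) = 0" "\<kappa> (w \<ominus> u) = 0" "\<kappa> (v \<ominus> w) = 0"
    unfolding d using C D t by (simp_all add: \<kappa>_mult)
  then have "\<kappa> (u \<ominus> v) = 0" "\<kappa> (u \<ominus> w) = 0" "\<kappa> (w \<ominus> v) = 0"
    using \<kappa>_diff_commute C(1) vw ne by metis+
  then show "?f x \<in> ?L" using ne vw C(1) k
    by (auto simp: x triangles_def paley_adj_iff simp flip: v_def w_def)
next
  fix xs assume xs: "xs \<in> ?L"
  then obtain u v w where uvw: "xs = [u, v, w]" by (auto simp: length_Suc_conv numeral_3_eq_3)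
  have C: "u \<in> carrier R" "v \<in> carrier R" "w \<in> carrier R" "u \<noteq> v" "u \<noteq> w" "v \<noteq> w"
    "\<kappa> (v \<ominus> u) = 0" "\<kappa> (w \<ominus> u) = 0" "\<kappa> (v \<ominus> w) = 0"
    using xs by (auto simp: uvw triangles_def paley_adj_iff)
  define h t where "h = v \<ominus> u" and "t = inv h \<otimes> (w \<ominus> u)"
  have h: "h \<in> carrier R" "h \<noteq> \<zero>" "\<kappa> h = 0" using C by (auto simp: h_def)
  then have ih: "inv h \<in> carrier R" "inv h \<noteq> \<zero>" "h \<otimes> inv h = \<one>" "inv h \<otimes> h = \<one>" "\<kappa> (inv h) = 0"
    using field_Units \<kappa>_inv[of h] by auto
  have t: "t \<in> carrier R" "t \<noteq> \<zero>" "\<kappa> t = 0"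
    using C h ih by (auto simp: t_def integral_iff \<kappa>_mult)
  have "h \<otimes> t = (h \<otimes> inv h) \<otimes> (w \<ominus> u)" unfolding t_def
    by (rule m_assoc[symmetric]) (use C ih h in auto)
  then have ht: "h \<otimes> t = w \<ominus> u" using ih C by simp
  have "\<one> \<ominus> t = inv h \<otimes> h \<ominus> inv h \<otimes> (w \<ominus> u)" using ih by (simp add: t_def)
  also have "\<dots> = inv h \<otimes> (v \<ominus> w)" unfolding h_def[symmetric] 
  proof -
    have "h \<ominus> (w \<ominus> u) = v \<ominus> w" unfolding h_def using C(1-3) by algebra
    moreover have "inv h \<otimes> h \<ominus> inv h \<otimes> (w \<ominus> u) = inv h \<otimes> (h \<ominus> (w \<ominus> u))"
      using ih(1) h(1) C(1-3) by algebra
    ultimately show "inv h \<otimes> h \<ominus> inv h \<otimes> (w \<ominus> u) = inv h \<otimes> (v \<ominus> w)" by simp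
  qed
  finally have mt: "\<one> \<ominus> t = inv h \<otimes> (v \<ominus> w)" .
  have "\<one> \<ominus> t \<noteq> \<zero>" unfolding mt using C ih by (simp add: integral_iff)
  then have "t \<noteq> \<one>" by (auto simp: a_minus_def r_neg)
  moreover have "\<kappa> (\<one> \<ominus> t) = 0" unfolding mt using C ih by (simp add: \<kappa>_mult)
  ultimately have "t \<in> cyc 0 0" using t by (simp add: cyc_def units1_def)
  moreover have "u \<oplus> h = v" unfolding h_def using C(1,2) by algebra
  moreover have "u \<oplus> h \<otimes> t = w" unfolding ht using C(1,3) by algebra
  ultimately show "\<exists>x\<in>?A. xs = ?f x" using h C(1)
    by (intro bexI[of _ "(u, h, t)"]) (auto simp: uvw)
qed

text \<open>The 18 is 6 for the orderings times 3 from \<open>q - 1 = 3 * m\<close>.\<close>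

lemma num_triangles_paley:
  "18 * num_triangles (generalized_paley_graph 3 R) = order R * (order R - 1) * card (cyc 0 0)"
proof -
  have "6 * num_triangles (generalized_paley_graph 3 R)
      = card (carrier R \<times> {h \<in> carrier R - {\<zero>}. \<kappa> h = 0} \<times> cyc 0 0)"
    using bij_betw_same_card[OF paley_triangle_lists]
      card_triangle_lists[of "generalized_paley_graph 3 R"] by simp
  also have "\<dots> = order R * (m * card (cyc 0 0))"
    unfolding card_cartesian_product card_class[OF zero_less_numeral] order_def ..
  finally show ?thesis by (simp add: order_eq algebra_simps)
qed

end

section \<open>Fields of prime power order and the closed formula\<close>

lemma cubic_field_exists:
  fixes R :: "('a, 'm) ring_scheme"
  assumes "field R" "order R = q" "[q = 1] (mod 3)" "q > 1"
  obtains g m where "cubic_field R g m"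
proof -
  interpret field R by fact
  have fin: "finite (carrier R)" using assms(2,4) by (auto simp: order_def intro: card_ge_0_finite)
  obtain g where g: "g \<in> carrier (mult_of R)" "carrier (mult_of R) = {g [^]\<^bsub>R\<^esub> i | i :: nat. i \<in> UNIV}"
    using finite_field_mult_group_has_gen[OF fin] by blast
  have "q mod 3 = 1" using assms(3) by (simp add: cong_def)
  then obtain m where "q = 3 * m + 1" by (metis mod_div_decomp mult.commute)
  then have "cubic_field R g m"
    by unfold_locales (use fin g assms(2) in auto)
  then show ?thesis using that by blast
qed

lemma prime_power_cong_1:
  fixes p :: nat
  assumes "prime p" "[p = 1] (mod 3)" "l \<ge> 1"
  shows "[p ^ l = 1] (mod 3)" "p ^ l > 1"
  using cong_pow[OF assms(2), of l] assms(3) prime_gt_1_nat[OF assms(1)] one_less_power[of p l] by auto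

text \<open>In the residue field modulo \<open>p\<close>, parity lets
  \<open>c ^ 2 + 27 * d ^ 2 = 4 * p\<close> be divided by 4.\<close>

lemma normalized_solution_exists:
  assumes "admissible_prime p"
  shows "\<exists>x y. normalized_solution p x y"
proof -
  note p = admissible_primeD[OF assms]
  obtain h0 :: int where h0: "[2 = h0 ^ 3] (mod int p)"
    using assms by (auto simp: admissible_prime_def cubic_residue_def)
  define R where "R = residue_ring (int p)"
  interpret residues_prime p R
    by unfold_locales (use p R_def in auto)
  have ord: "order R = p ^ 1" by (simp add: order_def res_carrier_eq)
  obtain g m where "cubic_field R g m"
    using cubic_field_exists[OF is_field ord] prime_power_cong_1[OF p(1,2), of 1] by auto
  then interpret F: cubic_field R g m .
  obtain c d where cd: "9 * int (card (F.cyc 0 0)) = c + int p ^ 1 - 8"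
    "c ^ 2 + 27 * d ^ 2 = 4 * int p ^ 1" "[c = 1] (mod 3)" "\<not> int p dvd c"
    using F.card_cyc_00[OF p(1) ord p(2)] by auto
  have two: "\<one>\<^bsub>R\<^esub> \<oplus>\<^bsub>R\<^esub> \<one>\<^bsub>R\<^esub> = 2"
    using p(3) by (simp add: res_add_eq res_one_eq)
  have "odd (card (F.cyc 0 0))"
  proof (rule F.odd_card_cyc_00[of "h0 mod int p"])
    show "(h0 mod int p) [^]\<^bsub>R\<^esub> (3 :: nat) = \<one>\<^bsub>R\<^esub> \<oplus>\<^bsub>R\<^esub> \<one>\<^bsub>R\<^esub>"
      using h0 p(3) by (simp add: two pow_cong cong_def)
  qed (use two in \<open>auto simp: res_zero_eq\<close>)
  then have "odd (9 * int (card (F.cyc 0 0)))" by simp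
  then have c_even: "even c" using p(4) unfolding cd(1) by simp
  then obtain e where e: "c = 2 * e" ..
  have "even (4 * int p - c ^ 2)" using c_even by simp
  then have "even (27 * d ^ 2)" using cd(2) by (metis add_diff_cancel_left' power_one_right)
  then have "even d" by simp
  then obtain y where y: "d = 2 * y" ..
  \<comment> \<open>The sign is forced: \<open>2 * e\<close> is 1 modulo 3, so it is
    \<open>- e\<close>, not \<open>e\<close>, that is 1 modulo 3.\<close>
  have eq: "int p = (- e) ^ 2 + 27 * y ^ 2" using cd(2) by (simp add: e y power_mult_distrib)
  have "\<not> int p dvd - e" using cd(4) e by auto
  then have "coprime (- e) (int p)"
    using p(1) prime_imp_coprime[of "int p" "- e"] by (simp add: coprime_commute)
  moreover have "[- e = 1] (mod 3)"
    using cd(3) e unfolding cong_iff_dvd_diff by presburger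
  ultimately show ?thesis using eq unfolding normalized_solution_def by blast
qed

text \<open>The number \<open>c\<close> from the cyclotomic count and \<open>- 2 * X\<close> from
  the powers of the solution satisfy the same norm equation, so they agree up to sign, and residues
  modulo 3 decide the sign.\<close>

lemma num_triangles_paley_formula:
  fixes S :: "('a, 'm) ring_scheme"
  assumes "admissible_prime p" "normalized_solution p x y" "l \<ge> 1" "field S" "order S = p ^ l"
  shows "of_nat (num_triangles (generalized_paley_graph 3 S)) =
    of_nat (p ^ l) * (of_nat (p ^ l) - 1) * (of_nat (p ^ l) + c_coeff x y l - 8) / 162"
proof -
  note p = admissible_primeD[OF assms(1)]
  obtain g m where "cubic_field S g m"
    using cubic_field_exists[OF assms(4,5)] prime_power_cong_1[OF p(1,2) assms(3)] by auto
  then interpret F: cubic_field S g m .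
  obtain c d where cd: "9 * int (card (F.cyc 0 0)) = c + int p ^ l - 8"
    "c ^ 2 + 27 * d ^ 2 = 4 * int p ^ l" "[c = 1] (mod 3)" "\<not> int p dvd c"
    using F.card_cyc_00[OF p(1) assms(5) p(2) assms(3)] by auto
  obtain X Y :: int where XY: "c_coeff x y l = of_int (- 2 * X)" "X ^ 2 + 27 * Y ^ 2 = int p ^ l"
    "[X = 1] (mod 3)" "\<not> int p dvd X"
    using c_coeff_norm_form[OF assms(2) p(1,4) assms(3)] by blast
  have "c = 2 * X \<or> c = - 2 * X"
    by (rule norm_form_unique[of "int p" l c d X Y]) (use p cd XY assms(3) in auto)
  then have c: "c = - 2 * X" using cd(3) XY(3) unfolding cong_iff_dvd_diff by presburger
  let ?N = "num_triangles (generalized_paley_graph 3 S)"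
  have "int (18 * ?N) = int (p ^ l * (p ^ l - 1) * card (F.cyc 0 0))"
    using F.num_triangles_paley assms(5) by simp
  then have "162 * int ?N = int (p ^ l) * (int (p ^ l) - 1) * (9 * int (card (F.cyc 0 0)))"
    using prime_power_cong_1(2)[OF p(1,2) assms(3)] by (simp add: of_nat_diff)
  also have "\<dots> = int (p ^ l) * (int (p ^ l) - 1) * (int (p ^ l) + - 2 * X - 8)"
    unfolding cd(1) c by simp
  finally have "(of_int (162 * int ?N) :: complex)
    = of_int (int (p ^ l) * (int (p ^ l) - 1) * (int (p ^ l) + - 2 * X - 8))" by simp
  then show ?thesis unfolding XY(1) by (simp add: mult.commute)
qed

lemma c_coeff_1: "c_coeff x y 1 = of_int (- 2 * x)"
  by (simp add: c_coeff_def)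

text \<open>A change of sign of \<open>y\<close> exchanges the two conjugate powers.\<close>

lemma c_coeff_cong_square:
  assumes "y ^ 2 = y' ^ 2"
  shows "c_coeff x y l = c_coeff x y' l"
  using assms by (auto simp: power2_eq_iff c_coeff_def)

text \<open>The formula for \<open>l = 1\<close> determines \<open>p\<close> and \<open>x\<close>,
  hence \<open>y\<close> up to sign.\<close>

lemma normalized_solution_unique:
  assumes "admissible_prime p" "normalized_solution p x y"
    and "admissible_prime p'" "normalized_solution p' x' y'"
    and "(of_nat (p ^ 1) * (of_nat (p ^ 1) - 1) * (of_nat (p ^ 1) + c_coeff x y 1 - 8) / 162 :: complex)
      = of_nat (p' ^ 1) * (of_nat (p' ^ 1) - 1) * (of_nat (p' ^ 1) + c_coeff x' y' 1 - 8) / 162"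
  shows "p = p'" "c_coeff x y l = c_coeff x' y' l"
proof -
  note p = admissible_primeD[OF assms(1)] and p' = admissible_primeD[OF assms(3)]
  have "(of_int (int p * (int p - 1) * (int p - 2 * x - 8)) :: complex)
      = of_int (int p' * (int p' - 1) * (int p' - 2 * x' - 8))"
    using assms(5) unfolding c_coeff_1 by simp
  then have "int p * (int p - 1) * (int p - 2 * x - 8) = int p' * (int p' - 1) * (int p' - 2 * x' - 8)"
    by (simp only: of_int_eq_iff)
  then have eq: "p = p'" "x = x'"
    using normalized_triangle_formula_inj[OF p(1,4) p'(1,4) assms(2,4)] by auto
  then show "p = p'" by simp
  have "y ^ 2 = y' ^ 2" using assms(2,4) eq by (simp add: normalized_solution_def)
  then show "c_coeff x y l = c_coeff x' y' l" using eq c_coeff_cong_square[of y y' x' l] by simp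
qed

text \<open>That one count determines the others is expressed by a single \<open>F\<close>, which
  receives \<open>l\<close> and the count over the prime field but not the prime.\<close>

theorem theorem3p4:
  shows "(\<exists>F :: nat \<Rightarrow> nat \<Rightarrow> nat.
            \<forall>(p::nat) (l::nat) (R :: 'a ring) (S :: 'b ring).
              admissible_prime p \<and> l \<ge> 1 \<and>
              field R \<and> order R = p \<and> field S \<and> order S = p ^ l \<longrightarrow>
                num_triangles (generalized_paley_graph 3 S) =
                F l (num_triangles (generalized_paley_graph 3 R)))
       \<and> (\<forall>p::nat. admissible_prime p \<longrightarrow>
            (\<exists>x y :: int. normalized_solution p x y) \<and>
            (\<forall>(x::int) (y::int) (l::nat) (S :: 'b ring).
              normalized_solution p x y \<and> l \<ge> 1 \<and> field S \<and> order S = p ^ l \<longrightarrow>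
                of_nat (num_triangles (generalized_paley_graph 3 S)) =
                of_nat (p ^ l) * (of_nat (p ^ l) - 1) * (of_nat (p ^ l) + c_coeff x y l - 8) / 162))"
proof (intro conjI allI impI)
  define K :: "nat \<Rightarrow> int \<Rightarrow> int \<Rightarrow> nat \<Rightarrow> complex" where
    "K = (\<lambda>p x y l. of_nat (p ^ l) * (of_nat (p ^ l) - 1) * (of_nat (p ^ l) + c_coeff x y l - 8) / 162)"
  \<comment> \<open>\<open>F\<close> chooses a value of the formula at \<open>l\<close> for some
    admissible prime and solution whose value at 1 is \<open>t\<close>; injectivity of the case
    \<open>l = 1\<close> makes that value unique.\<close>
  define F where "F = (\<lambda>l t. SOME n :: nat. \<exists>p x y. admissible_prime p \<and> normalized_solution p x y \<and>
    of_nat t = K p x y 1 \<and> of_nat n = K p x y l)"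
  show "\<exists>F :: nat \<Rightarrow> nat \<Rightarrow> nat. \<forall>(p::nat) (l::nat) (R :: 'a ring) (S :: 'b ring).
              admissible_prime p \<and> l \<ge> 1 \<and>
              field R \<and> order R = p \<and> field S \<and> order S = p ^ l \<longrightarrow>
                num_triangles (generalized_paley_graph 3 S) =
                F l (num_triangles (generalized_paley_graph 3 R))"
  proof (intro exI[of _ F] allI impI, elim conjE)
    fix p l :: nat and R :: "'a ring" and S :: "'b ring"
    assume p: "admissible_prime p" and l: "l \<ge> 1" and R: "field R" "order R = p"
      and S: "field S" "order S = p ^ l"
    let ?t = "num_triangles (generalized_paley_graph 3 R)"
    let ?n = "num_triangles (generalized_paley_graph 3 S)"
    obtain x y where xy: "normalized_solution p x y" using normalized_solution_exists[OF p] by blast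
    have t: "of_nat ?t = K p x y 1"
      unfolding K_def by (rule num_triangles_paley_formula[OF p xy]) (use R in auto)
    have n: "of_nat ?n = K p x y l"
      unfolding K_def by (rule num_triangles_paley_formula[OF p xy l S])
    have "F l ?t = ?n"
      unfolding F_def
    proof (rule some_equality)
      show "\<exists>p x y. admissible_prime p \<and> normalized_solution p x y \<and>
          of_nat ?t = K p x y 1 \<and> of_nat ?n = K p x y l"
        using p xy t n by blast
      fix k assume "\<exists>p x y. admissible_prime p \<and> normalized_solution p x y \<and>
          of_nat ?t = K p x y 1 \<and> of_nat k = K p x y l"
      then obtain p' x' y' where p': "admissible_prime p'" "normalized_solution p' x' y'"
        "of_nat ?t = K p' x' y' 1" "of_nat k = K p' x' y' l" by blast
      have "K p x y 1 = K p' x' y' 1" using t p'(3) by simp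
      note u = normalized_solution_unique[OF p xy p'(1,2) this[unfolded K_def]]
      have "K p x y l = K p' x' y' l" unfolding K_def u(1) u(2)[of l] ..
      then have "(of_nat k :: complex) = of_nat ?n" using n p'(4) by simp
      then show "k = ?n" by (simp only: of_nat_eq_iff)
    qed
    then show "?n = F l ?t" ..
  qed
qed (use normalized_solution_exists num_triangles_paley_formula in blast)+

end
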